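(* Let $X_1\subseteq X_2$ be finite metric spaces with a common distinguished point $a_0\in X_1$. Let $P_1\subseteq\mathcal{P}_{X_1}$ with $P_1=P_1^{-1}$ and $X_1\setminus\{a_0\}\subseteq P_1(a_0)$, and let $(Y_1,\phi_1)$ be a finite minimal $P_1$-type S-extension of $X_1$. Let $P_1\subseteq P_2\subseteq\mathcal{P}_{X_2}$ with $P_2=P_2^{-1}$ and $X_2\setminus\{a_0\}\subseteq P_2(a_0)$. Then there is a finite minimal $P_2$-type S-extension $(Y_2,\phi_2)$ of $X_2$ such that $(Y_1,\phi_1)$ and $(Y_2,\phi_2)$ are coherent.
   Context: A metric space $Y$ extends $X$ if $X\subseteq Y$ and $d_Y\restriction X=d_X$. A partial isometry of $X$ is an isometry between finite subsets of $X$; $\mathcal{P}_X$ is the set of partial isometries of $X$ that are not restrictions of the identity. $P(a_0)=\{p(a_0): p\in P, a_0\in\mathrm{dom}(p)\}$ and $P^{-1}=\{p^{-1}:p\in P\}$. For a finite metric space $X$, $a_0\in X$ and $P\subseteq\mathcal{P}_X$ with $P=P^{-1}$ and $X\setminus\{a_0\}\subseteq P(a_0)$, a $P$-type S-extension of $X$ is a pair $(Y,\phi)$ where $Y$ extends $X$ and $\phi:P\to\mathrm{Iso}(Y)$ with $\phi(p)\restriction\mathrm{dom}(p)=p$ for all $p\in P$; one assumes $\phi(p^{-1})=\phi(p)^{-1}$ and extends $\phi$ to a group homomorphism $\mathbb{F}(P)\to\mathrm{Iso}(Y)$, where $\mathbb{F}(P)$ is the free group on $P$ with $p^{-1}\in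 P$ identified with the formal inverse of $p$. It is minimal if every $y\in Y$ equals $\phi(g)(a_0)$ for some $g\in\mathbb{F}(P)$. For $X_1\subseteq X_2$, a $P_1$-type S-extension $(Y_1,\phi_1)$ of $X_1$ and a $P_2$-type S-extension $(Y_2,\phi_2)$ of $X_2$ with $P_1\subseteq P_2$, they are coherent if (i) $Y_2$ extends $Y_1$, (ii) $\phi_2(p)$ extends $\phi_1(p)$ for all $p\in P_1$, and (iii) with $K_i=\phi_i(\mathbb{F}(P_i))$, the assignment $\phi_1(p)\mapsto\phi_2(p)$ ($p\in P_1$) extends uniquely to an injective group homomorphism $K_1\to K_2$.
   Formalization: It is assumed in addition that the metrics of X_2 and Y_1 agree on X_2 ∩ Y_1 (automatic if X_2 ∩ Y_1 = X_1, and necessary since Y_2 must extend both); all spaces are subsets of one infinite ambient set. *)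

theory Defs
  imports "HOL-Analysis.Abstract_Metric_Spaces" "HOL-Algebra.Bij"
begin

definition metric_extends :: "'a metric \<Rightarrow> 'a metric \<Rightarrow> bool"
  where "metric_extends Y X \<longleftrightarrow>
    mspace X \<subseteq> mspace Y \<and> (\<forall>x\<in>mspace X. \<forall>y\<in>mspace X. mdist Y x y = mdist X x y)"

text \<open>
  A partial map is represented by its graph, so that domain, inverse and extension of partial maps
  are \<^const>\<open>Domain\<close>, \<^const>\<open>converse\<close> and inclusion. Preservation of distances makes the inverse
  relation single-valued as well.
\<close>

definition partial_isometry :: "'a metric \<Rightarrow> ('a \<times> 'a) set \<Rightarrow> bool"
  where "partial_isometry X p \<longleftrightarrow>
    finite p \<and> p \<subseteq> mspace X \<times> mspace X \<and> single_valued p \<and>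
    (\<forall>(x, x')\<in>p. \<forall>(y, y')\<in>p. mdist X x' y' = mdist X x y)"

definition partial_isometries :: "'a metric \<Rightarrow> ('a \<times> 'a) set set"
  where "partial_isometries X = {p. partial_isometry X p \<and> \<not> p \<subseteq> Id}"

definition images_of :: "('a \<times> 'a) set set \<Rightarrow> 'a \<Rightarrow> 'a set"
  where "images_of P a = {b. \<exists>p\<in>P. (a, b) \<in> p}"

text \<open>Like \<^const>\<open>Bij\<close>, isometries take the value \<^const>\<open>undefined\<close> outside the space.\<close>

definition isometries :: "'a metric \<Rightarrow> ('a \<Rightarrow> 'a) set"
  where "isometries Y =
    {f \<in> Bij (mspace Y). \<forall>x\<in>mspace Y. \<forall>y\<in>mspace Y. mdist Y (f x) (f y) = mdist Y x y}"

definition Iso :: "'a metric \<Rightarrow> ('a \<Rightarrow> 'a) monoid"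
  where "Iso Y = (BijGroup (mspace Y)) \<lparr>carrier := isometries Y\<rparr>"

text \<open>
  The free group on \<open>P\<close>, where \<open>P\<close> is closed under inverses and the formal inverse of \<open>p\<close> is
  identified with \<^term>\<open>p\<inverse>\<close>: words over \<open>P\<close> modulo cancellation of adjacent letters \<open>p\<close> and \<^term>\<open>p\<inverse>\<close>.
  For a letter with \<^prop>\<open>p\<inverse> = p\<close> the identification forces the square of \<open>p\<close> to be trivial.
\<close>

definition cancel :: "('a \<times> 'a) set set \<Rightarrow> (('a \<times> 'a) set list \<times> ('a \<times> 'a) set list) set"
  where "cancel P = {(u @ [p, p\<inverse>] @ v, u @ v) | u p v. u \<in> lists P \<and> p \<in> P \<and> v \<in> lists P}"

definition word_rel :: "('a \<times> 'a) set set \<Rightarrow> (('a \<times> 'a) set list \<times> ('a \<times> 'a) set list) set"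
  where "word_rel P = (cancel P \<union> (cancel P)\<inverse>)\<^sup>* \<inter> (lists P \<times> lists P)"

definition free_group :: "('a \<times> 'a) set set \<Rightarrow> ('a \<times> 'a) set list set monoid"
  where "free_group P =
    \<lparr>carrier = lists P // word_rel P,
     mult = (\<lambda>A B. \<Union>u\<in>A. \<Union>v\<in>B. word_rel P `` {u @ v}),
     one = word_rel P `` {[]}\<rparr>"

definition word_eval :: "('g, 'b) monoid_scheme \<Rightarrow> ('c \<Rightarrow> 'g) \<Rightarrow> 'c list \<Rightarrow> 'g"
  where "word_eval G f w = foldr (\<lambda>p g. f p \<otimes>\<^bsub>G\<^esub> g) w \<one>\<^bsub>G\<^esub>"

text \<open>
  The homomorphism induced on the free group by a map \<open>f\<close> with \<open>f (p\<inverse>) = inv (f p)\<close>; all words in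
  a class then have the same value, which is what \<^const>\<open>the_elem\<close> selects.
\<close>

definition free_lift :: "('g, 'b) monoid_scheme \<Rightarrow> (('a \<times> 'a) set \<Rightarrow> 'g) \<Rightarrow> ('a \<times> 'a) set list set \<Rightarrow> 'g"
  where "free_lift G f C = the_elem (word_eval G f ` C)"

definition S_extension ::
    "'a metric \<Rightarrow> ('a \<times> 'a) set set \<Rightarrow> 'a metric \<Rightarrow> (('a \<times> 'a) set \<Rightarrow> 'a \<Rightarrow> 'a) \<Rightarrow> bool"
  where "S_extension X P Y \<phi> \<longleftrightarrow>
    metric_extends Y X \<and>
    \<phi> \<in> P \<rightarrow> carrier (Iso Y) \<and>
    (\<forall>p\<in>P. \<forall>(x, y)\<in>p. \<phi> p x = y) \<and>
    (\<forall>p\<in>P. \<phi> (p\<inverse>) = inv\<^bsub>Iso Y\<^esub> \<phi> p)"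

definition minimal_S_extension ::
    "'a \<Rightarrow> 'a metric \<Rightarrow> ('a \<times> 'a) set set \<Rightarrow> 'a metric \<Rightarrow> (('a \<times> 'a) set \<Rightarrow> 'a \<Rightarrow> 'a) \<Rightarrow> bool"
  where "minimal_S_extension a X P Y \<phi> \<longleftrightarrow>
    S_extension X P Y \<phi> \<and>
    (\<forall>y\<in>mspace Y. \<exists>g\<in>carrier (free_group P). y = free_lift (Iso Y) \<phi> g a)"

definition image_group ::
    "('a \<times> 'a) set set \<Rightarrow> 'a metric \<Rightarrow> (('a \<times> 'a) set \<Rightarrow> 'a \<Rightarrow> 'a) \<Rightarrow> ('a \<Rightarrow> 'a) monoid"
  where "image_group P Y \<phi> =
    (Iso Y) \<lparr>carrier := free_lift (Iso Y) \<phi> ` carrier (free_group P)\<rparr>"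

text \<open>
  Homomorphisms in \<^const>\<open>mon\<close> are only determined on the carrier, so uniqueness is stated among
  functions that are \<^const>\<open>extensional\<close> there.
\<close>

definition coherent ::
    "('a \<times> 'a) set set \<Rightarrow> 'a metric \<Rightarrow> (('a \<times> 'a) set \<Rightarrow> 'a \<Rightarrow> 'a) \<Rightarrow>
     ('a \<times> 'a) set set \<Rightarrow> 'a metric \<Rightarrow> (('a \<times> 'a) set \<Rightarrow> 'a \<Rightarrow> 'a) \<Rightarrow> bool"
  where "coherent P\<^sub>1 Y\<^sub>1 \<phi>\<^sub>1 P\<^sub>2 Y\<^sub>2 \<phi>\<^sub>2 \<longleftrightarrow>
    metric_extends Y\<^sub>2 Y\<^sub>1 \<and>
    (\<forall>p\<in>P\<^sub>1. \<forall>y\<in>mspace Y\<^sub>1. \<phi>\<^sub>2 p y = \<phi>\<^sub>1 p y) \<and>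
    (\<exists>!h. h \<in> extensional (carrier (image_group P\<^sub>1 Y\<^sub>1 \<phi>\<^sub>1)) \<and>
          h \<in> mon (image_group P\<^sub>1 Y\<^sub>1 \<phi>\<^sub>1) (image_group P\<^sub>2 Y\<^sub>2 \<phi>\<^sub>2) \<and>
          (\<forall>p\<in>P\<^sub>1. h (\<phi>\<^sub>1 p) = \<phi>\<^sub>2 p))"


subsection \<open>Well-definedness of the constructions\<close>

lemma subgroup_isometries: "subgroup (isometries Y) (BijGroup (mspace Y))"
proof -
  interpret group "BijGroup (mspace Y)" by (rule group_BijGroup)
  have inv_eq: "inv\<^bsub>BijGroup (mspace Y)\<^esub> f = (\<lambda>x\<in>mspace Y. inv_into (mspace Y) f x)"
    if "f \<in> Bij (mspace Y)" for f
    by (rule inv_equality)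
       (use that in \<open>auto simp: BijGroup_def restrict_inv_into_Bij Bij_compose_restrict_eq\<close>)
  show ?thesis
  proof (rule subgroupI)
    show "isometries Y \<subseteq> carrier (BijGroup (mspace Y))"
      by (auto simp: isometries_def BijGroup_def)
    have "(\<lambda>x\<in>mspace Y. x) \<in> isometries Y"
      by (auto simp: isometries_def id_Bij)
    then show "isometries Y \<noteq> {}" by blast
    show "inv\<^bsub>BijGroup (mspace Y)\<^esub> f \<in> isometries Y" if "f \<in> isometries Y" for f
    proof -
      have f: "f \<in> Bij (mspace Y)"
        and d: "\<And>x y. x \<in> mspace Y \<Longrightarrow> y \<in> mspace Y \<Longrightarrow> mdist Y (f x) (f y) = mdist Y x y"
        using that by (auto simp: isometries_def)
      have "f ` mspace Y = mspace Y" using f by (auto simp: Bij_def bij_betw_def)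
      then have "mdist Y (inv_into (mspace Y) f x) (inv_into (mspace Y) f y) = mdist Y x y"
        if "x \<in> mspace Y" "y \<in> mspace Y" for x y
        using d[of "inv_into (mspace Y) f x" "inv_into (mspace Y) f y"] that
        by (simp add: f_inv_into_f inv_into_into)
      then show ?thesis
        using f by (simp add: inv_eq isometries_def restrict_inv_into_Bij)
    qed
    show "f \<otimes>\<^bsub>BijGroup (mspace Y)\<^esub> g \<in> isometries Y"
      if "f \<in> isometries Y" "g \<in> isometries Y" for f g
    proof -
      have "g \<in> mspace Y \<rightarrow> mspace Y" using that by (auto simp: isometries_def Bij_imp_funcset)
      then have "g x \<in> mspace Y" if "x \<in> mspace Y" for x using that by blast
      then show ?thesis
        using that by (simp add: isometries_def BijGroup_def compose_Bij compose_eq)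
    qed
  qed
qed

lemma group_Iso: "group (Iso Y)"
  unfolding Iso_def
  by (rule subgroup.subgroup_is_group[OF subgroup_isometries group_BijGroup])

lemma equiv_word_rel: "equiv (lists P) (word_rel P)"
proof (rule equivI)
  show "refl_on (lists P) (word_rel P)" by (auto simp: refl_on_def word_rel_def)
  show "sym (word_rel P)"
    unfolding word_rel_def by (intro sym_Int sym_rtrancl sym_Un_converse) (simp add: sym_def)
  show "trans (word_rel P)" by (auto simp: word_rel_def trans_def)
qed (auto simp: word_rel_def)

lemma cancel_append:
  assumes "(u, v) \<in> cancel P \<union> (cancel P)\<inverse>" "x \<in> lists P" "y \<in> lists P"
  shows "(x @ u @ y, x @ v @ y) \<in> cancel P \<union> (cancel P)\<inverse>"
proof -
  have "(x @ u @ y, x @ v @ y) \<in> cancel P" if uv: "(u, v) \<in> cancel P" for u v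
  proof -
    obtain s p t where "u = s @ [p, p\<inverse>] @ t" "v = s @ t" "s \<in> lists P" "p \<in> P" "t \<in> lists P"
      using uv unfolding cancel_def by blast
    then show ?thesis
      unfolding cancel_def using assms(2,3)
      by (intro CollectI exI[of _ "x @ s"] exI[of _ p] exI[of _ "t @ y"]) auto
  qed
  then show ?thesis using assms(1) by blast
qed

lemma word_rel_append:
  assumes "(u, u') \<in> word_rel P" "(v, v') \<in> word_rel P"
  shows "(u @ v, u' @ v') \<in> word_rel P"
proof -
  let ?r = "cancel P \<union> (cancel P)\<inverse>"
  have ctx: "(x @ a @ y, x @ b @ y) \<in> ?r\<^sup>*"
    if "(a, b) \<in> ?r\<^sup>*" "x \<in> lists P" "y \<in> lists P" for a b x y
    using that(1)
  proof (induction rule: rtrancl_induct)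
    case (step b c)
    then show ?case using cancel_append[OF step(2) that(2,3)] by (rule_tac rtrancl_into_rtrancl)
  qed simp
  have L: "u \<in> lists P" "u' \<in> lists P" "v \<in> lists P" "v' \<in> lists P"
    and r: "(u, u') \<in> ?r\<^sup>*" "(v, v') \<in> ?r\<^sup>*"
    using assms by (auto simp: word_rel_def)
  have "(u @ v, u' @ v) \<in> ?r\<^sup>*" using ctx[OF r(1), of "[]" v] L by simp
  moreover have "(u' @ v, u' @ v') \<in> ?r\<^sup>*" using ctx[OF r(2), of u' "[]"] L by simp
  ultimately have "(u @ v, u' @ v') \<in> ?r\<^sup>*" by (rule rtrancl_trans)
  then show ?thesis using L by (simp add: word_rel_def)
qed

lemma free_group_mult_class:
  assumes "u \<in> lists P" "v \<in> lists P"
  shows "word_rel P `` {u} \<otimes>\<^bsub>free_group P\<^esub> word_rel P `` {v} = word_rel P `` {u @ v}"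
proof -
  have "word_rel P `` {u' @ v'} = word_rel P `` {u @ v}"
    if "(u, u') \<in> word_rel P" "(v, v') \<in> word_rel P" for u' v'
    using equiv_class_eq[OF equiv_word_rel word_rel_append[OF that]] by simp
  then have "(\<Union>u'\<in>word_rel P `` {u}. \<Union>v'\<in>word_rel P `` {v}. word_rel P `` {u' @ v'}) =
      (\<Union>u'\<in>word_rel P `` {u}. \<Union>v'\<in>word_rel P `` {v}. word_rel P `` {u @ v})"
    by (intro SUP_cong refl) (auto simp only: Image_singleton_iff)
  moreover have "u \<in> word_rel P `` {u}" "v \<in> word_rel P `` {v}"
    using assms by (auto simp: word_rel_def)
  ultimately show ?thesis unfolding free_group_def by (simp del: UN_simps) blast
qed

lemma free_group_carrierE:
  assumes "C \<in> carrier (free_group P)"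
  obtains u where "u \<in> lists P" "C = word_rel P `` {u}"
  using assms unfolding free_group_def by (metis partial_object.select_convs(1) quotientE)

lemma free_group_class_in_carrier:
  "u \<in> lists P \<Longrightarrow> word_rel P `` {u} \<in> carrier (free_group P)"
  by (auto simp: free_group_def intro: quotientI)

lemma word_rel_inverse:
  assumes "converse ` P = P" "u \<in> lists P"
  shows "(rev (map converse u) @ u, []) \<in> word_rel P"
  using assms(2)
proof (induction u)
  case Nil
  then show ?case by (simp add: word_rel_def)
next
  case (Cons p u)
  then have p: "p \<in> P" "p\<inverse> \<in> P" and u: "u \<in> lists P" using assms(1) by auto
  have ru: "rev (map converse u) \<in> lists P" using u assms(1) by (auto simp: in_lists_conv_set)
  have "(rev (map converse u) @ [p\<inverse>, (p\<inverse>)\<inverse>] @ u, rev (map converse u) @ u) \<in> cancel P"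
    unfolding cancel_def using p u ru by blast
  then have "(rev (map converse (p # u)) @ p # u, rev (map converse u) @ u) \<in> word_rel P"
    using p u ru by (auto simp: word_rel_def)
  moreover have "(rev (map converse u) @ u, []) \<in> word_rel P" using Cons.IH u by simp
  ultimately show ?case using equiv_word_rel by (meson equivE transD)
qed

lemma group_free_group:
  assumes "converse ` P = P"
  shows "group (free_group P)"
proof (rule groupI)
  have one: "\<one>\<^bsub>free_group P\<^esub> = word_rel P `` {[]}" by (simp add: free_group_def)
  show "\<one>\<^bsub>free_group P\<^esub> \<in> carrier (free_group P)"
    by (simp add: one free_group_class_in_carrier)
  show "A \<otimes>\<^bsub>free_group P\<^esub> B \<in> carrier (free_group P)"
    if "A \<in> carrier (free_group P)" "B \<in> carrier (free_group P)" for A B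
    using that(2) that(1)
    by (elim free_group_carrierE)
       (simp only: free_group_mult_class free_group_class_in_carrier append_in_lists_conv simp_thms)
  show "A \<otimes>\<^bsub>free_group P\<^esub> B \<otimes>\<^bsub>free_group P\<^esub> C = A \<otimes>\<^bsub>free_group P\<^esub> (B \<otimes>\<^bsub>free_group P\<^esub> C)"
    if A: "A \<in> carrier (free_group P)" and B: "B \<in> carrier (free_group P)"
      and C: "C \<in> carrier (free_group P)" for A B C
  proof -
    obtain u where u: "u \<in> lists P" "A = word_rel P `` {u}"
      using A by (rule free_group_carrierE)
    obtain v where v: "v \<in> lists P" "B = word_rel P `` {v}"
      using B by (rule free_group_carrierE)
    obtain w where w: "w \<in> lists P" "C = word_rel P `` {w}"
      using C by (rule free_group_carrierE)
    have "u @ v \<in> lists P" "v @ w \<in> lists P" using u v w by simp_all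
    then show ?thesis using u v w by (simp only: free_group_mult_class append_assoc)
  qed
  show "\<one>\<^bsub>free_group P\<^esub> \<otimes>\<^bsub>free_group P\<^esub> A = A" if "A \<in> carrier (free_group P)" for A
    using that
    by (elim free_group_carrierE) (simp only: one free_group_mult_class lists.Nil append_Nil)
  show "\<exists>B\<in>carrier (free_group P). B \<otimes>\<^bsub>free_group P\<^esub> A = \<one>\<^bsub>free_group P\<^esub>"
    if A: "A \<in> carrier (free_group P)" for A
  proof -
    obtain u where u: "u \<in> lists P" "A = word_rel P `` {u}"
      using A by (rule free_group_carrierE)
    have ru: "rev (map converse u) \<in> lists P" using u assms by (auto simp: in_lists_conv_set)
    have "word_rel P `` {rev (map converse u)} \<otimes>\<^bsub>free_group P\<^esub> A = \<one>\<^bsub>free_group P\<^esub>"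
      using equiv_class_eq[OF equiv_word_rel word_rel_inverse[OF assms u(1)]]
      by (simp add: u(2) one free_group_mult_class[OF ru u(1)])
    then show ?thesis using free_group_class_in_carrier[OF ru] by blast
  qed
qed

context
  fixes G :: "('g, 'b) monoid_scheme" and P :: "('a \<times> 'a) set set" and f
  assumes G: "group G" and P: "converse ` P = P" and f: "f \<in> P \<rightarrow> carrier G"
    and f_inv: "\<And>p. p \<in> P \<Longrightarrow> f (p\<inverse>) = inv\<^bsub>G\<^esub> f p"
begin

interpretation group G by (rule G)

lemma word_eval_closed: "w \<in> lists P \<Longrightarrow> word_eval G f w \<in> carrier G"
  using f by (induction w) (auto simp: word_eval_def)

lemma word_eval_append:
  "u \<in> lists P \<Longrightarrow> v \<in> lists P \<Longrightarrow> word_eval G f (u @ v) = word_eval G f u \<otimes>\<^bsub>G\<^esub> word_eval G f v"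
proof (induction u)
  case Nil
  then show ?case using word_eval_closed[of v] by (simp add: word_eval_def)
next
  case (Cons p u)
  then have "f p \<in> carrier G" "word_eval G f u \<in> carrier G" "word_eval G f v \<in> carrier G"
    using f word_eval_closed by auto
  then show ?case using Cons by (simp add: word_eval_def m_assoc)
qed

lemma word_eval_cancel:
  assumes "(u, v) \<in> cancel P"
  shows "word_eval G f u = word_eval G f v"
proof -
  obtain s p t where *: "u = s @ [p, p\<inverse>] @ t" "v = s @ t" "s \<in> lists P" "p \<in> P" "t \<in> lists P"
    using assms unfolding cancel_def by blast
  have p': "p\<inverse> \<in> P" using * P by blast
  have "f p \<in> carrier G" using f * by blast
  then have pp: "word_eval G f [p, p\<inverse>] = \<one>\<^bsub>G\<^esub>" using f_inv * by (simp add: word_eval_def)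
  have lists: "[p, p\<inverse>] \<in> lists P" "[p, p\<inverse>] @ t \<in> lists P" using * p' by simp_all
  have "word_eval G f u = word_eval G f s \<otimes>\<^bsub>G\<^esub> (word_eval G f [p, p\<inverse>] \<otimes>\<^bsub>G\<^esub> word_eval G f t)"
    unfolding *(1) using * lists by (simp only: word_eval_append)
  also have "\<dots> = word_eval G f s \<otimes>\<^bsub>G\<^esub> word_eval G f t"
    using pp word_eval_closed[OF *(5)] by simp
  also have "\<dots> = word_eval G f v"
    unfolding *(2) using * by (simp only: word_eval_append)
  finally show ?thesis .
qed

lemma word_eval_word_rel:
  assumes "(u, v) \<in> word_rel P"
  shows "word_eval G f u = word_eval G f v"
proof -
  have "(u, v) \<in> (cancel P \<union> (cancel P)\<inverse>)\<^sup>*" using assms by (simp add: word_rel_def)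
  then show ?thesis
  proof (induction rule: rtrancl_induct)
    case (step v w)
    then show ?case using word_eval_cancel[of v w] word_eval_cancel[of w v] by auto
  qed simp
qed

lemma free_lift_class:
  assumes "w \<in> lists P"
  shows "free_lift G f (word_rel P `` {w}) = word_eval G f w"
proof -
  have "(w, w) \<in> word_rel P" using assms by (simp add: word_rel_def)
  moreover have "word_eval G f u = word_eval G f w" if "(w, u) \<in> word_rel P" for u
    using word_eval_word_rel[OF that] by (rule sym)
  ultimately have "word_eval G f ` (word_rel P `` {w}) = {word_eval G f w}"
    by blast
  then show ?thesis by (simp add: free_lift_def)
qed

lemma free_lift_hom: "free_lift G f \<in> hom (free_group P) G"
proof (rule homI)
  fix A B assume "A \<in> carrier (free_group P)" "B \<in> carrier (free_group P)"
  then obtain u v where "u \<in> lists P" "A = word_rel P `` {u}" "v \<in> lists P" "B = word_rel P `` {v}"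
    by (elim free_group_carrierE) blast
  then show "free_lift G f (A \<otimes>\<^bsub>free_group P\<^esub> B) = free_lift G f A \<otimes>\<^bsub>G\<^esub> free_lift G f B"
    "free_lift G f A \<in> carrier G"
    by (auto simp: free_group_mult_class free_lift_class word_eval_append word_eval_closed)
qed

lemma free_lift_generator: "p \<in> P \<Longrightarrow> free_lift G f (word_rel P `` {[p]}) = f p"
  using f by (simp add: free_lift_class word_eval_def Pi_iff)

end

end

theory Submission
  imports Defs
begin

text \<open>
  Amalgamate \<open>X\<^sub>2\<close> and \<open>Y\<^sub>1\<close> over their intersection to a finite metric space \<open>Z\<close>. Every finite metric space
  \<open>Z\<close> embeds in a finite one to which all partial isometries of \<open>Z\<close> extend coherently: if the range of
  \<open>p\<close> is the domain of \<open>q\<close>, the extension of the composition is the composition of the extensions.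
  Isometries of \<open>Y\<^sub>1\<close> are partial isometries of \<open>Z\<close> with the same domain and range, so coherence gives a
  homomorphism from the isometry group of \<open>Y\<^sub>1\<close>, and the orbit of \<open>a\<^sub>0\<close> is the required extension.

  The coherent extension follows Hubicka, Konecny and Nesetril. Start from a finite weighted graph on
  which the partial isometries act, and unwind its shortest non-metric cycles: replace each vertex by
  the pairs of the vertex and a 0-1 valuation of these cycles, and let an edge of such a cycle survive
  between two pairs iff the valuations agree at the cycle, except for the longest edge, where they must
  differ. Parity prevents the cycle from lifting. Non-metric cycles have bounded length since
  only finitely many distances occur, so after finitely many steps the path metric extends \<open>Z\<close>.
\<close>

subsection \<open>Partial isometries\<close>

lemma partial_isometry_converse:
  assumes "partial_isometry Z p"
  shows "partial_isometry Z (p\<inverse>)"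
proof -
  have "x = x'" if "(x, y) \<in> p" "(x', y) \<in> p" for x x' y
  proof -
    have "x \<in> mspace Z" "x' \<in> mspace Z" "y \<in> mspace Z" "mdist Z y y = mdist Z x x'"
      using assms that unfolding partial_isometry_def by blast+
    then show ?thesis by (metis mdist_zero)
  qed
  then have "single_valued (p\<inverse>)" unfolding single_valued_def by blast
  moreover have "mdist Z x' y' = mdist Z x y" if "(x, x') \<in> p\<inverse>" "(y, y') \<in> p\<inverse>" for x x' y y'
  proof -
    have "(x', x) \<in> p" "(y', y) \<in> p" using that by auto
    then show ?thesis using assms unfolding partial_isometry_def by fastforce
  qed
  moreover have "finite (p\<inverse>)" "p\<inverse> \<subseteq> mspace Z \<times> mspace Z"
    using assms by (auto simp: partial_isometry_def)
  ultimately show ?thesis unfolding partial_isometry_def by blast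
qed

lemma partial_isometry_relcomp:
  assumes "partial_isometry Z p" "partial_isometry Z q"
  shows "partial_isometry Z (p O q)"
proof -
  have "finite (p O q)" using assms by (auto simp: partial_isometry_def)
  moreover have "single_valued (p O q)"
    using assms by (auto simp: partial_isometry_def intro: single_valued_relcomp)
  moreover have "p O q \<subseteq> mspace Z \<times> mspace Z"
    using assms unfolding partial_isometry_def by blast
  moreover have "mdist Z x' y' = mdist Z x y" if "(x, x') \<in> p O q" "(y, y') \<in> p O q" for x x' y y'
  proof -
    obtain u v where uv: "(x, u) \<in> p" "(u, x') \<in> q" "(y, v) \<in> p" "(v, y') \<in> q"
      using \<open>(x, x') \<in> p O q\<close> \<open>(y, y') \<in> p O q\<close> by blast
    then have "mdist Z x' y' = mdist Z u v" "mdist Z u v = mdist Z x y"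
      using assms unfolding partial_isometry_def by blast+
    then show ?thesis by simp
  qed
  ultimately show ?thesis unfolding partial_isometry_def by blast
qed

lemma partial_isometry_mspace:
  assumes "partial_isometry Z p" "(x, y) \<in> p"
  shows "x \<in> mspace Z" "y \<in> mspace Z"
  using assms unfolding partial_isometry_def by blast+

lemma partial_isometry_mdist:
  assumes "partial_isometry Z p" "(x, x') \<in> p" "(y, y') \<in> p"
  shows "mdist Z x' y' = mdist Z x y"
  using assms unfolding partial_isometry_def by blast

lemma partial_isometry_unique:
  assumes "partial_isometry Z p" "(x, y) \<in> p" "(x, y') \<in> p"
  shows "y = y'"
  using assms unfolding partial_isometry_def single_valued_def by blast

lemma partial_isometry_inj:
  assumes "partial_isometry Z p" "(x, y) \<in> p" "(x', y) \<in> p"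
  shows "x = x'"
  using partial_isometry_unique[OF partial_isometry_converse[OF assms(1)]] assms(2,3) by blast

lemma partial_isometry_extends:
  assumes "metric_extends Z X" "partial_isometry X p"
  shows "partial_isometry Z p"
proof -
  have p: "finite p" "p \<subseteq> mspace X \<times> mspace X" "single_valued p"
    using assms(2) by (auto simp: partial_isometry_def)
  have X: "mspace X \<subseteq> mspace Z" using assms(1) by (simp add: metric_extends_def)
  have "mdist Z x' y' = mdist Z x y" if xy: "(x, x') \<in> p" "(y, y') \<in> p" for x x' y y'
  proof -
    have "mdist X x' y' = mdist X x y"
      using assms(2) xy unfolding partial_isometry_def by blast
    moreover have "x \<in> mspace X" "x' \<in> mspace X" "y \<in> mspace X" "y' \<in> mspace X"
      using p(2) xy by auto
    ultimately show ?thesis using assms(1) by (simp add: metric_extends_def)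
  qed
  then show ?thesis using p X unfolding partial_isometry_def by blast
qed


subsection \<open>Coherent actions\<close>

text \<open>The set \<open>V\<close> acted on has a type of its own, so that the notion covers
  actions on points as well as on cycles and other obstacles. Relational composition
  \<open>p O q\<close> applies \<open>p\<close> first. Only the values of \<open>\<alpha> p\<close>
  on \<open>V\<close> matter.\<close>

definition coherent_action :: "'a metric \<Rightarrow> 'b set \<Rightarrow> (('a \<times> 'a) set \<Rightarrow> 'b \<Rightarrow> 'b) \<Rightarrow> bool"
  where "coherent_action Z V \<alpha> \<longleftrightarrow>
    (\<forall>p. partial_isometry Z p \<longrightarrow> \<alpha> p \<in> V \<rightarrow> V) \<and>
    (\<forall>p. partial_isometry Z p \<and> p \<subseteq> Id \<longrightarrow> (\<forall>x\<in>V. \<alpha> p x = x)) \<and>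
    (\<forall>p q. partial_isometry Z p \<and> partial_isometry Z q \<and> Range p = Domain q \<longrightarrow>
      (\<forall>x\<in>V. \<alpha> (p O q) x = \<alpha> q (\<alpha> p x)))"

lemma coherent_action_closed:
  "coherent_action Z V \<alpha> \<Longrightarrow> partial_isometry Z p \<Longrightarrow> x \<in> V \<Longrightarrow> \<alpha> p x \<in> V"
  by (auto simp: coherent_action_def)

lemma coherent_action_id:
  "coherent_action Z V \<alpha> \<Longrightarrow> partial_isometry Z p \<Longrightarrow> p \<subseteq> Id \<Longrightarrow> x \<in> V \<Longrightarrow> \<alpha> p x = x"
  by (auto simp: coherent_action_def)

lemma coherent_action_comp:
  "coherent_action Z V \<alpha> \<Longrightarrow> partial_isometry Z p \<Longrightarrow> partial_isometry Z q \<Longrightarrow>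
    Range p = Domain q \<Longrightarrow> x \<in> V \<Longrightarrow> \<alpha> (p O q) x = \<alpha> q (\<alpha> p x)"
  by (simp add: coherent_action_def)

text \<open>The range of \<open>p\<close> is the domain of its converse, so coherence applies to the
  two; as \<open>p\<close> is injective, their composition is a partial identity and acts
  trivially.\<close>

lemma coherent_action_converse:
  assumes "coherent_action Z V \<alpha>" "partial_isometry Z p" "x \<in> V"
  shows "\<alpha> (p\<inverse>) (\<alpha> p x) = x"
proof -
  have c: "partial_isometry Z (p\<inverse>)" using assms(2) by (rule partial_isometry_converse)
  have "p O p\<inverse> \<subseteq> Id"
    using partial_isometry_inj[OF assms(2)] by blast
  then show ?thesis
    using coherent_action_comp[OF assms(1,2) c _ assms(3)]
      coherent_action_id[OF assms(1) partial_isometry_relcomp[OF assms(2) c] _ assms(3)]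
    by simp
qed

lemma coherent_action_converse':
  assumes "coherent_action Z V \<alpha>" "partial_isometry Z p" "x \<in> V"
  shows "\<alpha> p (\<alpha> (p\<inverse>) x) = x"
  using coherent_action_converse[OF assms(1) partial_isometry_converse[OF assms(2)] assms(3)] by simp

lemma coherent_action_inj:
  assumes "coherent_action Z V \<alpha>" "partial_isometry Z p" "x \<in> V" "y \<in> V" "\<alpha> p x = \<alpha> p y"
  shows "x = y"
  using assms coherent_action_converse by metis

definition extending_action :: "'a metric \<Rightarrow> 'a set \<Rightarrow> (('a \<times> 'a) set \<Rightarrow> 'a \<Rightarrow> 'a) \<Rightarrow> bool"
  where "extending_action Z V \<alpha> \<longleftrightarrow>
    mspace Z \<subseteq> V \<and> coherent_action Z V \<alpha> \<and>
    (\<forall>p. partial_isometry Z p \<longrightarrow> (\<forall>(x, y)\<in>p. \<alpha> p x = y))"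

lemma extending_actionD:
  assumes "extending_action Z V \<alpha>"
  shows "mspace Z \<subseteq> V" "coherent_action Z V \<alpha>"
    "partial_isometry Z p \<Longrightarrow> (x, y) \<in> p \<Longrightarrow> \<alpha> p x = y"
  using assms unfolding extending_action_def by auto

section \<open>Unwinding over a finite family of obstacles\<close>

lemma inj_extending_section:
  fixes e :: "'a \<Rightarrow> 'b"
  assumes "infinite (UNIV :: 'a set)" "finite U" "finite Z" "inj_on e Z"
  obtains g where "inj_on g U" "\<And>x. x \<in> Z \<Longrightarrow> g (e x) = x"
proof -
  have "infinite (UNIV - Z)" using assms by (simp add: Diff_infinite_finite)
  then obtain C where C: "C \<subseteq> UNIV - Z" "finite C" "card C = card (U - e ` Z)"
    by (meson infinite_arbitrarily_large)
  then obtain h where h: "bij_betw h (U - e ` Z) C"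
    using assms(2) by (metis finite_Diff finite_same_card_bij)
  define g where "g u = (if u \<in> e ` Z then inv_into Z e u else h u)" for u
  have hC: "h u \<in> C" if "u \<in> U" "u \<notin> e ` Z" for u
    using h that by (auto simp: bij_betw_def)
  have "inj_on g U"
  proof (rule inj_onI)
    fix u v assume "u \<in> U" "v \<in> U" "g u = g v"
    then show "u = v"
      using hC[of u] hC[of v] C(1) inv_into_into[of u e Z] inv_into_into[of v e Z]
        inv_into_injective[of Z e u v] bij_betw_imp_inj_on[OF h]
      by (auto simp: g_def split: if_splits dest: inj_onD)
  qed
  moreover have "g (e x) = x" if "x \<in> Z" for x
    using that assms(4) by (simp add: g_def)
  ultimately show thesis using that by blast
qed

text \<open>
  In the flip \<open>F p M\<close> below the choice of \<open>z\<close> is irrelevant by \<open>cons\<close>; making the flip depend on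
  \<open>p\<close> and \<open>M\<close> only keeps all comparisons of valuations on the support of \<open>M\<close> intact.
\<close>

lemma unwinding:
  fixes Z :: "'a metric" and Ms :: "'m set"
  assumes inf: "infinite (UNIV :: 'a set)" and fV: "finite V" and fM: "finite Ms"
    and \<alpha>: "extending_action Z V \<alpha>" and \<beta>: "coherent_action Z Ms \<beta>"
    and supp: "\<And>p M. partial_isometry Z p \<Longrightarrow> M \<in> Ms \<Longrightarrow> supp (\<beta> p M) = \<alpha> p ` supp M"
    and suppV: "\<And>M. M \<in> Ms \<Longrightarrow> supp M \<subseteq> V"
    and \<gamma>: "\<And>x M. x \<in> mspace Z \<Longrightarrow> M \<in> \<gamma> x \<Longrightarrow> M \<in> Ms \<and> x \<in> supp M"
    and cons: "\<And>p x x' y y' M. partial_isometry Z p \<Longrightarrow> (x, x') \<in> p \<Longrightarrow> (y, y') \<in> p \<Longrightarrow> M \<in> Ms \<Longrightarrow>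
      x \<in> supp M \<Longrightarrow> y \<in> supp M \<Longrightarrow>
      ((\<beta> p M \<in> \<gamma> x') \<noteq> (\<beta> p M \<in> \<gamma> y')) = ((M \<in> \<gamma> x) \<noteq> (M \<in> \<gamma> y))"
  obtains V' \<alpha>' \<pi> val where "finite V'" "extending_action Z V' \<alpha>'"
    "\<And>x. x \<in> V' \<Longrightarrow> \<pi> x \<in> V" "\<And>x. x \<in> mspace Z \<Longrightarrow> \<pi> x = x" "\<And>x. x \<in> mspace Z \<Longrightarrow> val x = \<gamma> x"
    "\<And>p x. partial_isometry Z p \<Longrightarrow> x \<in> V' \<Longrightarrow> \<pi> (\<alpha>' p x) = \<alpha> p (\<pi> x)"
    "\<And>p x y M. partial_isometry Z p \<Longrightarrow> x \<in> V' \<Longrightarrow> y \<in> V' \<Longrightarrow> M \<in> Ms \<Longrightarrow>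
      \<pi> x \<in> supp M \<Longrightarrow> \<pi> y \<in> supp M \<Longrightarrow>
      ((\<beta> p M \<in> val (\<alpha>' p x)) \<noteq> (\<beta> p M \<in> val (\<alpha>' p y))) = ((M \<in> val x) \<noteq> (M \<in> val y))"
proof -
  note \<alpha>D = extending_actionD[OF \<alpha>]
  define F where "F p M \<longleftrightarrow> (\<exists>(z, z')\<in>p. z \<in> supp M \<and> (M \<in> \<gamma> z) \<noteq> (\<beta> p M \<in> \<gamma> z'))" for p M
  have F: "F p M \<longleftrightarrow> (M \<in> \<gamma> z) \<noteq> (\<beta> p M \<in> \<gamma> z')"
    if "partial_isometry Z p" "M \<in> Ms" "(z, z') \<in> p" "z \<in> supp M" for p M z z'
    unfolding F_def using that cons[OF that(1) _ that(3) that(2) _ that(4)] by blast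
  define U where "U = V \<times> Pow Ms"
  \<comment> \<open>A valuation is coded by the set of obstacles of value 1. The new value at
    \<open>N\<close> is the old value at its preimage under \<open>\<beta> p\<close>, flipped if the
    flip of that preimage is on and the vertex lies in its support.\<close>
  define A where "A p u = (\<alpha> p (fst u), {N \<in> Ms. (\<beta> (p\<inverse>) N \<in> snd u) \<noteq>
      (fst u \<in> supp (\<beta> (p\<inverse>) N) \<and> F p (\<beta> (p\<inverse>) N))})" for p u
  have fstA: "fst (A p u) = \<alpha> p (fst u)" for p u by (simp add: A_def)
  have sndA: "\<beta> p M \<in> snd (A p u) \<longleftrightarrow> (M \<in> snd u) \<noteq> (fst u \<in> supp M \<and> F p M)"
    if "partial_isometry Z p" "M \<in> Ms" for p u M
    using that by (simp add: A_def coherent_action_converse[OF \<beta>] coherent_action_closed[OF \<beta>])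
  have A_in: "A p u \<in> U" if "partial_isometry Z p" "u \<in> U" for p u
    using that coherent_action_closed[OF \<alpha>D(2)] by (auto simp: A_def U_def)
  \<comment> \<open>As \<open>\<beta> p\<close> permutes \<open>Ms\<close>, it suffices to compare
    valuations at the coordinates \<open>\<beta> p M\<close>, where \<open>sndA\<close> computes
    them.\<close>
  have U_eqI: "u = v" if "u \<in> U" "v \<in> U" "fst u = fst v" "partial_isometry Z p"
    "\<And>M. M \<in> Ms \<Longrightarrow> \<beta> p M \<in> snd u \<longleftrightarrow> \<beta> p M \<in> snd v" for u v p
  proof -
    have "N \<in> snd u \<longleftrightarrow> N \<in> snd v" if "N \<in> Ms" for N
      using \<open>\<And>M. M \<in> Ms \<Longrightarrow> \<beta> p M \<in> snd u \<longleftrightarrow> \<beta> p M \<in> snd v\<close>[of "\<beta> (p\<inverse>) N"] that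
        coherent_action_converse'[OF \<beta> \<open>partial_isometry Z p\<close> that]
        coherent_action_closed[OF \<beta> partial_isometry_converse[OF \<open>partial_isometry Z p\<close>] that]
      by simp
    then show ?thesis using that unfolding U_def by (auto simp: prod_eq_iff)
  qed
  have supp_iff: "\<alpha> p x \<in> supp (\<beta> p M) \<longleftrightarrow> x \<in> supp M"
    if "partial_isometry Z p" "M \<in> Ms" "x \<in> V" for p M x
    using that suppV[OF that(2)] coherent_action_inj[OF \<alpha>D(2) that(1,3)] by (auto simp: supp)
  have act: "coherent_action Z U A"
    unfolding coherent_action_def
  proof (intro conjI allI impI ballI funcsetI; (elim conjE)?)
    fix p u assume "partial_isometry Z p" "u \<in> U"
    then show "A p u \<in> U" by (rule A_in)
  next
    fix p u assume p: "partial_isometry Z p" "p \<subseteq> Id" and u: "u \<in> U"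
    have id: "\<beta> p M = M" if "M \<in> Ms" for M using coherent_action_id[OF \<beta> p that] .
    have "\<not> F p M" if "M \<in> Ms" for M
      using p(2) id[OF that] unfolding F_def by auto
    then show "A p u = u"
      using u p coherent_action_id[OF \<alpha>D(2) p, of "fst u"] sndA[OF p(1)]
      by (intro U_eqI[OF A_in[OF p(1) u] u _ p(1)]) (auto simp: fstA U_def id)
  next
    fix p q u
    assume p: "partial_isometry Z p" and q: "partial_isometry Z q" and pq: "Range p = Domain q"
      and u: "u \<in> U"
    have r: "partial_isometry Z (p O q)" using p q by (rule partial_isometry_relcomp)
    have uV: "fst u \<in> V" using u by (auto simp: U_def)
    show "A (p O q) u = A q (A p u)"
    proof (rule U_eqI[OF A_in[OF r u] A_in[OF q A_in[OF p u]] _ r])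
      show "fst (A (p O q) u) = fst (A q (A p u))"
        using coherent_action_comp[OF \<alpha>D(2) p q pq uV] by (simp add: fstA)
      fix M assume M: "M \<in> Ms"
      have \<beta>M: "\<beta> p M \<in> Ms" using coherent_action_closed[OF \<beta> p M] .
      have comp: "\<beta> (p O q) M = \<beta> q (\<beta> p M)" using coherent_action_comp[OF \<beta> p q pq M] .
      \<comment> \<open>The cocycle rule: flips add modulo 2. If the support of \<open>M\<close>
        meets the domain of \<open>p\<close>, following one such point through \<open>p\<close> and
        \<open>q\<close> makes the middle value cancel. Otherwise, since the range of
        \<open>p\<close> is the domain of \<open>q\<close>, none of the three flips has a
        witness.\<close>
      have "F (p O q) M \<longleftrightarrow> F p M \<noteq> F q (\<beta> p M)"
      proof (cases "\<exists>z\<in>Domain p. z \<in> supp M")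
        case True
        then obtain z z' where z: "(z, z') \<in> p" "z \<in> supp M" by blast
        then obtain z'' where z'': "(z', z'') \<in> q" using pq by blast
        have "z' \<in> supp (\<beta> p M)" using z \<alpha>D(3)[OF p z(1)] supp[OF p M] by auto
        note Fq = F[OF q \<beta>M z'' this]
        have "(z, z'') \<in> p O q" using z(1) z'' by blast
        note Fr = F[OF r M this z(2)]
        show ?thesis unfolding F[OF p M z] Fq Fr comp by blast
      next
        case False
        have "z \<notin> supp (\<beta> p M)" if zz': "(z, z') \<in> q" for z z'
        proof
          assume z: "z \<in> supp (\<beta> p M)"
          obtain y where y: "(y, z) \<in> p" using zz' pq by blast
          have "\<alpha> p y \<in> supp (\<beta> p M)" using \<alpha>D(3)[OF p y] z by simp
          moreover have "y \<in> V" using \<alpha>D(1) partial_isometry_mspace[OF p y] by blast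
          ultimately have "y \<in> supp M" using supp_iff[OF p M] by simp
          then show False using False y by blast
        qed
        then show ?thesis using False unfolding F_def by blast
      qed
      moreover have "fst (A p u) \<in> supp (\<beta> p M) \<longleftrightarrow> fst u \<in> supp M"
        using supp_iff[OF p M uV] by (simp add: fstA)
      ultimately show "\<beta> (p O q) M \<in> snd (A (p O q) u) \<longleftrightarrow> \<beta> (p O q) M \<in> snd (A q (A p u))"
        using sndA[OF r M, of u] sndA[OF p M, of u] sndA[OF q \<beta>M, of "A p u"] unfolding comp
        by simp blast
    qed
  qed
  define e where "e x = (x, \<gamma> x)" for x
  have fZ: "finite (mspace Z)" using \<alpha>D(1) fV by (rule finite_subset)
  have fU: "finite U" using fV fM by (simp add: U_def)
  have eU: "e x \<in> U" if "x \<in> mspace Z" for x using that \<gamma> \<alpha>D(1) by (auto simp: e_def U_def)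
  \<comment> \<open>On the support the flip is exactly the discrepancy between the marks of
    \<open>x\<close> and of \<open>y\<close>; outside the support both marks are 0. So the embedded
    copy of \<open>Z\<close> is moved as \<open>p\<close> prescribes.\<close>
  have Ae: "A p (e x) = e y" if p: "partial_isometry Z p" and xy: "(x, y) \<in> p" for p x y
  proof (rule U_eqI[OF _ _ _ p])
    have xyZ: "x \<in> mspace Z" "y \<in> mspace Z" using partial_isometry_mspace[OF p xy] by auto
    show "e y \<in> U" "A p (e x) \<in> U" using eU A_in[OF p] xyZ by auto
    show "fst (A p (e x)) = fst (e y)" using \<alpha>D(3)[OF p xy] by (simp add: e_def A_def)
    fix M assume M: "M \<in> Ms"
    show "\<beta> p M \<in> snd (A p (e x)) \<longleftrightarrow> \<beta> p M \<in> snd (e y)"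
    proof (cases "x \<in> supp M")
      case True
      then show ?thesis using sndA[OF p M, of "e x"] F[OF p M xy True] by (auto simp: e_def)
    next
      case False
      then have "y \<notin> supp (\<beta> p M)"
        using supp_iff[OF p M, of x] \<alpha>D(1,3) xyZ p xy by auto
      then have "M \<notin> \<gamma> x" "\<beta> p M \<notin> \<gamma> y" using \<gamma> xyZ False by blast+
      then show ?thesis using sndA[OF p M, of "e x"] False by (simp add: e_def)
    qed
  qed
  obtain g where g: "inj_on g U" "\<And>x. x \<in> mspace Z \<Longrightarrow> g (e x) = x"
    using inj_extending_section[OF inf fU fZ, of e] by (auto simp: e_def inj_on_def)
  define i where "i = inv_into U g"
  have gi: "i (g u) = u" if "u \<in> U" for u using that g(1) by (simp add: i_def)
  have giA: "i (g (A p u)) = A p u" if "partial_isometry Z p" "u \<in> U" for p u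
    using gi[OF A_in[OF that]] .
  have iZ: "i x = e x" if "x \<in> mspace Z" for x using gi[OF eU[OF that]] g(2)[OF that] by simp
  show thesis
  proof
    show "finite (g ` U)" using fU by simp
    show "extending_action Z (g ` U) (\<lambda>p x. g (A p (i x)))"
      unfolding extending_action_def
    proof (intro conjI allI impI)
      show "mspace Z \<subseteq> g ` U" using g(2) eU by (metis image_eqI subsetI)
      show "coherent_action Z (g ` U) (\<lambda>p x. g (A p (i x)))"
        using act A_in gi unfolding coherent_action_def by (auto simp: Pi_iff)
      show "\<forall>(x, y)\<in>p. g (A p (i x)) = y" if "partial_isometry Z p" for p
        using that Ae iZ g(2) partial_isometry_mspace[OF that] by auto
    qed
    show "(fst \<circ> i) x \<in> V" if "x \<in> g ` U" for x using that gi by (auto simp: U_def)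
    show "(fst \<circ> i) x = x" "(snd \<circ> i) x = \<gamma> x" if "x \<in> mspace Z" for x
      using iZ[OF that] by (auto simp: e_def)
    show "(fst \<circ> i) (g (A p (i x))) = \<alpha> p ((fst \<circ> i) x)" if "partial_isometry Z p" "x \<in> g ` U" for p x
      using that gi by (auto simp: fstA giA)
    show "((\<beta> p M \<in> (snd \<circ> i) (g (A p (i x)))) \<noteq> (\<beta> p M \<in> (snd \<circ> i) (g (A p (i y))))) =
        ((M \<in> (snd \<circ> i) x) \<noteq> (M \<in> (snd \<circ> i) y))"
      if "partial_isometry Z p" "x \<in> g ` U" "y \<in> g ` U" "M \<in> Ms"
        "(fst \<circ> i) x \<in> supp M" "(fst \<circ> i) y \<in> supp M" for p x y M
      using that gi by (auto simp: giA sndA)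
  qed
qed


section \<open>Completion of partial isometries to permutations\<close>

lemma card_Domain_eq_card_Range:
  assumes "partial_isometry Z p"
  shows "card (Domain p) = card (Range p)"
proof -
  have "inj_on fst p" "inj_on snd p"
    using partial_isometry_unique[OF assms] partial_isometry_inj[OF assms]
    by (force simp: inj_on_def)+
  then show ?thesis
    by (simp add: Domain_fst Range_snd card_image)
qed

text \<open>
  Each complement of a domain or a range is identified with an initial segment of the naturals once
  and for all; this makes the completions of partial isometries to permutations compose.
\<close>

lemma extending_permutations:
  assumes "finite (mspace Z)"
  obtains \<alpha> where "extending_action Z (mspace Z) \<alpha>"
proof -
  let ?S = "mspace Z"
  have "\<exists>b. bij_betw b (?S - D) {0..<card (?S - D)}" for D
    using assms by (simp add: ex_bij_betw_finite_nat)
  then obtain b where b: "\<And>D. bij_betw (b D) (?S - D) {0..<card (?S - D)}" by metis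
  \<comment> \<open>A point off the domain goes to the point with the same number in the complement
    of the range. The two complements have the same size because a partial isometry is
    injective.\<close>
  define \<alpha> where "\<alpha> p x = (if x \<in> Domain p then THE y. (x, y) \<in> p
      else inv_into (?S - Range p) (b (Range p)) (b (Domain p) x))" for p x
  have on: "\<alpha> p x = y" if "partial_isometry Z p" "(x, y) \<in> p" for p x y
    using that partial_isometry_unique[OF that(1)] by (auto simp: \<alpha>_def)
  have off: "\<alpha> p x \<in> ?S - Range p" "b (Range p) (\<alpha> p x) = b (Domain p) x"
    if p: "partial_isometry Z p" and x: "x \<in> ?S" "x \<notin> Domain p" for p x
  proof -
    have sub: "Domain p \<subseteq> ?S" "Range p \<subseteq> ?S" using partial_isometry_mspace[OF p] by auto
    have "card (?S - Domain p) = card (?S - Range p)"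
      using card_Domain_eq_card_Range[OF p] sub assms
      by (simp add: card_Diff_subset finite_subset)
    then have im: "b (Domain p) x \<in> b (Range p) ` (?S - Range p)"
      using b[of "Domain p"] b[of "Range p"] x by (auto simp: bij_betw_def)
    show "\<alpha> p x \<in> ?S - Range p" using inv_into_into[OF im] x by (simp add: \<alpha>_def)
    show "b (Range p) (\<alpha> p x) = b (Domain p) x" using f_inv_into_f[OF im] x by (simp add: \<alpha>_def)
  qed
  have b_inj: "x = y" if "b D x = b D y" "x \<in> ?S - D" "y \<in> ?S - D" for x y D
    using that b[of D] by (auto simp: bij_betw_def dest: inj_onD)
  have closed: "\<alpha> p x \<in> ?S" if "partial_isometry Z p" "x \<in> ?S" for p x
    using that on off(1) partial_isometry_mspace(2) by (metis DiffD1 DomainE)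
  have "extending_action Z ?S \<alpha>"
    unfolding extending_action_def coherent_action_def
  proof (intro conjI allI impI ballI funcsetI; (elim conjE)?)
    show "\<alpha> p x \<in> ?S" if "partial_isometry Z p" "x \<in> ?S" for p x using closed that .
    show "case xy of (x, y) \<Rightarrow> \<alpha> p x = y" if "partial_isometry Z p" "xy \<in> p" for p xy
      using that on by auto
    show "\<alpha> p x = x" if "partial_isometry Z p" "p \<subseteq> Id" "x \<in> ?S" for p x
    proof (cases "x \<in> Domain p")
      case False
      have "Domain p = Range p" using that(2) by auto
      then show ?thesis
        using b_inj[of "Range p" "\<alpha> p x" x] off[OF that(1,3) False] that(3) False by simp
    qed (use that on in auto)
    show "\<alpha> (p O q) x = \<alpha> q (\<alpha> p x)"
      if p: "partial_isometry Z p" and q: "partial_isometry Z q"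
        and pq: "Range p = Domain q" and x: "x \<in> ?S" for p q x
    proof (cases "x \<in> Domain p")
      case True
      then obtain y z where "(x, y) \<in> p" "(y, z) \<in> q" using pq by blast
      then show ?thesis using on p q partial_isometry_relcomp[OF p q] by (metis relcompI)
    next
      case False
      have D: "Domain (p O q) = Domain p" "Range (p O q) = Range q" using pq by blast+
      have y: "\<alpha> p x \<in> ?S" "\<alpha> p x \<notin> Domain q" using off(1)[OF p x False] pq by auto
      have "b (Range q) (\<alpha> (p O q) x) = b (Range q) (\<alpha> q (\<alpha> p x))"
        using off(2)[OF partial_isometry_relcomp[OF p q] x] off(2)[OF p x False] off(2)[OF q y]
          False D pq by simp
      then show ?thesis
        using b_inj off(1)[OF partial_isometry_relcomp[OF p q] x] off(1)[OF q y] False D by metis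
    qed
  qed auto
  then show thesis by (rule that)
qed

section \<open>Weighted graphs with a coherent action\<close>

definition distances :: "'a metric \<Rightarrow> real set"
  where "distances Z = (\<lambda>(x, y). mdist Z x y) ` (mspace Z \<times> mspace Z)"

text \<open>The weight \<open>0\<close> means that there is no edge.\<close>

definition EPPA_graph ::
    "'a metric \<Rightarrow> 'a set \<Rightarrow> ('a \<Rightarrow> 'a \<Rightarrow> real) \<Rightarrow> (('a \<times> 'a) set \<Rightarrow> 'a \<Rightarrow> 'a) \<Rightarrow> bool"
  where "EPPA_graph Z V w \<alpha> \<longleftrightarrow>
    finite V \<and> extending_action Z V \<alpha> \<and>
    (\<forall>x\<in>V. w x x = 0) \<and> (\<forall>x\<in>V. \<forall>y\<in>V. w x y = w y x \<and> w x y \<in> insert 0 (distances Z)) \<and>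
    (\<forall>x\<in>mspace Z. \<forall>y\<in>mspace Z. w x y = mdist Z x y) \<and>
    (\<forall>p. partial_isometry Z p \<longrightarrow> (\<forall>x\<in>V. \<forall>y\<in>V. w (\<alpha> p x) (\<alpha> p y) = w x y))"

lemma EPPA_graphD:
  assumes "EPPA_graph Z V w \<alpha>"
  shows "finite V" "extending_action Z V \<alpha>" "x \<in> V \<Longrightarrow> w x x = 0"
    "x \<in> V \<Longrightarrow> y \<in> V \<Longrightarrow> w x y = w y x"
    "x \<in> V \<Longrightarrow> y \<in> V \<Longrightarrow> w x y \<in> insert 0 (distances Z)"
    "x \<in> V \<Longrightarrow> y \<in> V \<Longrightarrow> 0 \<le> w x y"
    "x \<in> mspace Z \<Longrightarrow> y \<in> mspace Z \<Longrightarrow> w x y = mdist Z x y"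
    "partial_isometry Z p \<Longrightarrow> x \<in> V \<Longrightarrow> y \<in> V \<Longrightarrow> w (\<alpha> p x) (\<alpha> p y) = w x y"
proof -
  show *: "x \<in> V \<Longrightarrow> y \<in> V \<Longrightarrow> w x y \<in> insert 0 (distances Z)"
    using assms unfolding EPPA_graph_def by blast
  show "x \<in> V \<Longrightarrow> y \<in> V \<Longrightarrow> 0 \<le> w x y"
    using * by (auto simp: distances_def)
qed (use assms in \<open>unfold EPPA_graph_def, blast+\<close>)

text \<open>
  The obstacle \<open>(u, v, t)\<close> stands for an edge of weight \<open>t\<close> from \<open>u\<close> to \<open>v\<close>, and two valuations are
  joined by the one weight whose obstacles they tell apart.
\<close>

lemma EPPA_graph_exists:
  fixes Z :: "'a metric"
  assumes inf: "infinite (UNIV :: 'a set)" and fZ: "finite (mspace Z)"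
  obtains V w \<alpha> where "EPPA_graph Z V w \<alpha>"
proof -
  obtain \<alpha> where \<alpha>: "extending_action Z (mspace Z) \<alpha>"
    using extending_permutations[OF fZ] .
  note \<alpha>D = extending_actionD[OF \<alpha>]
  define T where "T = distances Z - {0}"
  have fT: "finite T" using fZ by (simp add: T_def distances_def)
  define Ms where "Ms = {(u, v, t). u \<in> mspace Z \<and> v \<in> mspace Z \<and> u \<noteq> v \<and> t \<in> T}"
  define \<beta> :: "('a \<times> 'a) set \<Rightarrow> 'a \<times> 'a \<times> real \<Rightarrow> 'a \<times> 'a \<times> real"
    where "\<beta> p = (\<lambda>(u, v, t). (\<alpha> p u, \<alpha> p v, t))" for p
  define supp :: "'a \<times> 'a \<times> real \<Rightarrow> 'a set" where "supp = (\<lambda>(u, v, t). {u, v})"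
  \<comment> \<open>An obstacle is marked only at its first vertex, and only if its weight is the
    true distance. So its two vertices are told apart precisely when the weight is right, and
    partial isometries preserve this.\<close>
  define \<gamma> where "\<gamma> x = {(u, v, t) \<in> Ms. u = x \<and> t = mdist Z u v}" for x
  have "finite (mspace Z \<times> mspace Z \<times> T)" using fZ fT by simp
  then have fM: "finite Ms" by (rule rev_finite_subset) (auto simp: Ms_def)
  have \<beta>: "coherent_action Z Ms \<beta>"
    unfolding coherent_action_def
  proof (intro conjI allI impI ballI funcsetI; (elim conjE)?)
    fix p M assume p: "partial_isometry Z p" and M: "M \<in> Ms"
    show "\<beta> p M \<in> Ms"
      using M coherent_action_closed[OF \<alpha>D(2) p] coherent_action_inj[OF \<alpha>D(2) p]
      by (auto simp: Ms_def \<beta>_def)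
  next
    fix p M assume "partial_isometry Z p" "p \<subseteq> Id" "M \<in> Ms"
    then show "\<beta> p M = M" using coherent_action_id[OF \<alpha>D(2)] by (auto simp: Ms_def \<beta>_def)
  next
    fix p q M
    assume "partial_isometry Z p" "partial_isometry Z q" "Range p = Domain q" "M \<in> Ms"
    then show "\<beta> (p O q) M = \<beta> q (\<beta> p M)"
      using coherent_action_comp[OF \<alpha>D(2)] by (auto simp: Ms_def \<beta>_def)
  qed
  have cons: "((\<beta> p M \<in> \<gamma> x') \<noteq> (\<beta> p M \<in> \<gamma> y')) = ((M \<in> \<gamma> x) \<noteq> (M \<in> \<gamma> y))"
    if p: "partial_isometry Z p" and x: "(x, x') \<in> p" and y: "(y, y') \<in> p" and M: "M \<in> Ms"
      and xy: "x \<in> supp M" "y \<in> supp M" for p x x' y y' M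
  proof (cases "x = y")
    case True
    then show ?thesis using partial_isometry_unique[OF p] x y by blast
  next
    case False
    obtain u v t where uvt: "M = (u, v, t)" "u \<noteq> v" by (use M in \<open>auto simp: Ms_def\<close>)
    have ne: "x' \<noteq> y'" using False partial_isometry_inj[OF p] x y by blast
    have \<beta>M: "\<beta> p M \<in> Ms" using coherent_action_closed[OF \<beta> p M] .
    have "\<alpha> p x = x'" "\<alpha> p y = y'" using \<alpha>D(3)[OF p] x y by auto
    moreover have "mdist Z x' y' = mdist Z x y" "mdist Z y' x' = mdist Z y x"
      using partial_isometry_mdist[OF p] x y by auto
    moreover have "u = x \<and> v = y \<or> u = y \<and> v = x" using xy False by (auto simp: supp_def uvt)
    ultimately show ?thesis
      using M \<beta>M False ne by (auto simp: \<gamma>_def uvt \<beta>_def)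
  qed
  have supp_act: "supp (\<beta> p M) = \<alpha> p ` supp M" for p M
    by (auto simp: supp_def \<beta>_def split: prod.splits)
  have supp_sub: "supp M \<subseteq> mspace Z" if "M \<in> Ms" for M using that by (auto simp: supp_def Ms_def)
  have \<gamma>_sub: "M \<in> Ms \<and> x \<in> supp M" if "M \<in> \<gamma> x" for M x
    using that by (auto simp: supp_def \<gamma>_def)
  obtain V \<alpha>' \<pi> val where V: "finite V" "extending_action Z V \<alpha>'"
    "\<And>x. x \<in> V \<Longrightarrow> \<pi> x \<in> mspace Z" "\<And>x. x \<in> mspace Z \<Longrightarrow> \<pi> x = x"
    "\<And>x. x \<in> mspace Z \<Longrightarrow> val x = \<gamma> x"
    "\<And>p x. partial_isometry Z p \<Longrightarrow> x \<in> V \<Longrightarrow> \<pi> (\<alpha>' p x) = \<alpha> p (\<pi> x)"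
    "\<And>p x y M. partial_isometry Z p \<Longrightarrow> x \<in> V \<Longrightarrow> y \<in> V \<Longrightarrow> M \<in> Ms \<Longrightarrow>
      \<pi> x \<in> supp M \<Longrightarrow> \<pi> y \<in> supp M \<Longrightarrow>
      ((\<beta> p M \<in> val (\<alpha>' p x)) \<noteq> (\<beta> p M \<in> val (\<alpha>' p y))) = ((M \<in> val x) \<noteq> (M \<in> val y))"
    apply (rule unwinding[where supp = supp and \<gamma> = \<gamma>, OF inf fZ fM \<alpha> \<beta> supp_act supp_sub \<gamma>_sub cons]; assumption?)
    subgoal premises prems by (rule prems(1); fact prems)
    done
  \<comment> \<open>For \<open>t\<close> in \<open>T\<close> this makes \<open>t\<close> the only
    weight at which the valuations disagree on the obstacles from \<open>u\<close> to
    \<open>v\<close>, so an edge has a unique weight. Asking for it in both directions in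
    \<open>E\<close> makes edges symmetric.\<close>
  define sep where "sep x y u v t \<longleftrightarrow>
    (\<forall>t'\<in>T. (((u, v, t') \<in> val x) \<noteq> ((u, v, t') \<in> val y)) = (t' = t))" for x y u v t
  define E where "E x y t \<longleftrightarrow> \<pi> x \<noteq> \<pi> y \<and> t \<in> T \<and>
    sep x y (\<pi> x) (\<pi> y) t \<and> sep x y (\<pi> y) (\<pi> x) t" for x y t
  have sep_sym: "sep x y u v t \<longleftrightarrow> sep y x u v t" for x y u v t
    unfolding sep_def by (intro ball_cong refl) blast
  have E_sym: "E x y t \<longleftrightarrow> E y x t" for x y t
    unfolding E_def by (metis sep_sym)
  have E_unique: "t = t'" if "E x y t" "E x y t'" for x y t t'
    using that unfolding E_def sep_def by blast
  have E_act: "E (\<alpha>' p x) (\<alpha>' p y) t \<longleftrightarrow> E x y t"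
    if p: "partial_isometry Z p" and x: "x \<in> V" and y: "y \<in> V" for p x y t
  proof (cases "\<pi> x = \<pi> y")
    case True
    then show ?thesis using V(6)[OF p x] V(6)[OF p y] by (simp add: E_def)
  next
    case False
    have "((\<alpha> p u, \<alpha> p v, t) \<in> val (\<alpha>' p x)) \<noteq> ((\<alpha> p u, \<alpha> p v, t) \<in> val (\<alpha>' p y)) \<longleftrightarrow>
        ((u, v, t) \<in> val x) \<noteq> ((u, v, t) \<in> val y)"
      if "t \<in> T" "{u, v} = {\<pi> x, \<pi> y}" for u v t
    proof -
      have "(u, v, t) \<in> Ms" using that False V(3)[OF x] V(3)[OF y] by (auto simp: Ms_def doubleton_eq_iff)
      moreover have "\<pi> x \<in> supp (u, v, t)" "\<pi> y \<in> supp (u, v, t)" using that(2) by (auto simp: supp_def)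
      ultimately show ?thesis using V(7)[OF p x y, of "(u, v, t)"] by (simp add: \<beta>_def)
    qed
    then have "sep (\<alpha>' p x) (\<alpha>' p y) (\<alpha> p u) (\<alpha> p v) t \<longleftrightarrow> sep x y u v t"
      if "{u, v} = {\<pi> x, \<pi> y}" for u v
      using that unfolding sep_def by simp
    moreover have "\<alpha> p (\<pi> x) \<noteq> \<alpha> p (\<pi> y)"
      using coherent_action_inj[OF \<alpha>D(2) p] V(3)[OF x] V(3)[OF y] False by blast
    ultimately show ?thesis using False V(6)[OF p x] V(6)[OF p y] by (simp add: E_def insert_commute)
  qed
  have E_Z: "E x y t \<longleftrightarrow> t = mdist Z x y"
    if x: "x \<in> mspace Z" and y: "y \<in> mspace Z" and "x \<noteq> y" for x y t
  proof -
    have "mdist Z x y \<in> T" using that by (auto simp: T_def distances_def)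
    then show ?thesis
      using that by (auto simp: E_def sep_def V(4)[OF x] V(4)[OF y] V(5)[OF x] V(5)[OF y]
          \<gamma>_def Ms_def mdist_commute)
  qed
  define w where "w x y = (if \<exists>t. E x y t then THE t. E x y t else 0)" for x y
  have w_eq: "w x y = t" if "E x y t" for x y t
    using that E_unique by (auto simp: w_def)
  have "EPPA_graph Z V w \<alpha>'"
    unfolding EPPA_graph_def
  proof (intro conjI ballI allI impI)
    show "w x x = 0" for x by (simp add: w_def E_def)
    show "w x y = w y x" for x y
    proof -
      have "E x y = E y x" by (rule ext) (rule E_sym)
      then show ?thesis by (simp add: w_def)
    qed
    show "w x y \<in> insert 0 (distances Z)" for x y
    proof (cases "\<exists>t. E x y t")
      case True
      then show ?thesis using w_eq by (auto simp: E_def T_def)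
    qed (simp add: w_def)
    show "w x y = mdist Z x y" if "x \<in> mspace Z" "y \<in> mspace Z" for x y
    proof (cases "x = y")
      case True
      then show ?thesis using that by (simp add: w_def E_def)
    next
      case False
      then show ?thesis using w_eq E_Z[OF that] by simp
    qed
    show "w (\<alpha>' p x) (\<alpha>' p y) = w x y" if "partial_isometry Z p" "x \<in> V" "y \<in> V" for p x y
    proof -
      have "E (\<alpha>' p x) (\<alpha>' p y) = E x y" by (rule ext) (rule E_act[OF that])
      then show ?thesis by (simp add: w_def)
    qed
  qed (use V in auto)
  then show thesis by (rule that)
qed


subsection \<open>Removing non-metric cycles\<close>

fun walk_length :: "('a \<Rightarrow> 'a \<Rightarrow> real) \<Rightarrow> 'a list \<Rightarrow> real"
  where
    "walk_length w (x # y # zs) = w x y + walk_length w (y # zs)"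
  | "walk_length w _ = 0"

lemma walk_length_append:
  "walk_length w (xs @ z # ys) = walk_length w (xs @ [z]) + walk_length w (z # ys)"
  by (induction w xs rule: walk_length.induct) (auto split: list.splits simp: neq_Nil_conv)

lemma walk_length_map: "walk_length w (map f xs) = walk_length (\<lambda>x y. w (f x) (f y)) xs"
  by (induction xs rule: induct_list012) auto

lemma walk_length_cong:
  assumes "successively (\<lambda>x y. v x y = w x y) xs"
  shows "walk_length v xs = walk_length w xs"
  using assms by (induction w xs rule: walk_length.induct) auto

lemma walk_length_rev: "walk_length w (rev xs) = walk_length (\<lambda>x y. w y x) xs"
proof (induction w xs rule: walk_length.induct)
  case (1 w x y zs)
  then show ?case using walk_length_append[of w "rev zs" y "[x]"] by simp
qed auto

lemma walk_length_ge:
  assumes "successively (\<lambda>x y. c \<le> w x y) xs" "xs \<noteq> []"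
  shows "(real (length xs) - 1) * c \<le> walk_length w xs"
  using assms by (induction w xs rule: walk_length.induct) (auto simp: algebra_simps)

lemma walk_length_nonneg:
  assumes "successively (\<lambda>x y. 0 \<le> w x y) xs"
  shows "0 \<le> walk_length w xs"
  using assms by (induction w xs rule: walk_length.induct) auto

lemma edge_le_walk_length:
  assumes "successively (\<lambda>x y. 0 \<le> w x y) xs"
  shows "successively (\<lambda>x y. w x y \<le> walk_length w xs) xs"
  using assms
proof (induction w xs rule: walk_length.induct)
  case (1 w x y zs)
  then have "successively (\<lambda>a b. w a b \<le> walk_length w (y # zs)) (y # zs)" "0 \<le> w x y"
    "0 \<le> walk_length w (y # zs)"
    by (auto intro: walk_length_nonneg)
  then show ?case by (auto elim: successively_mono)
qed auto

lemma successively_conj: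
  "successively P xs \<Longrightarrow> successively Q xs \<Longrightarrow> successively (\<lambda>x y. P x y \<and> Q x y) xs"
  by (induction P xs rule: successively.induct) auto

lemma successively_eq_hd_last:
  "successively (\<lambda>x y. f x = f y) xs \<Longrightarrow> xs \<noteq> [] \<Longrightarrow> f (last xs) = f (hd xs)"
  by (induction "\<lambda>x y. f x = f y" xs rule: successively.induct) auto

text \<open>
  A walk along edges whose endpoints are joined by an edge longer than the walk: up to the choice of
  its longest edge, a non-metric cycle.
\<close>

definition shortcut :: "('a \<Rightarrow> 'a \<Rightarrow> real) \<Rightarrow> 'a list \<Rightarrow> bool"
  where "shortcut w xs \<longleftrightarrow>
    xs \<noteq> [] \<and> successively (\<lambda>x y. 0 < w x y) xs \<and> walk_length w xs < w (hd xs) (last xs)"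

lemma shortcut_map:
  assumes "\<And>x y. x \<in> set xs \<Longrightarrow> y \<in> set xs \<Longrightarrow> w (f x) (f y) = w x y"
  shows "shortcut w (map f xs) \<longleftrightarrow> shortcut w xs"
proof (cases "xs = []")
  case False
  have "successively (\<lambda>x y. w (f x) (f y) = w x y) xs"
    using assms by (induction xs rule: induct_list012) auto
  then have "walk_length w (map f xs) = walk_length w xs"
    by (simp add: walk_length_map walk_length_cong)
  moreover have "successively (\<lambda>x y. 0 < w (f x) (f y)) xs \<longleftrightarrow> successively (\<lambda>x y. 0 < w x y) xs"
    by (rule successively_cong) (use assms in auto)
  ultimately show ?thesis
    using False assms by (simp add: shortcut_def successively_map hd_map last_map)
qed (simp add: shortcut_def)

text \<open>A point of the metric space \<open>Z\<close> in the interior would split the walk into shorter shortcuts.\<close>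

lemma minimal_shortcut_interior:
  assumes xs: "shortcut w xs" and min: "\<And>ys. set ys \<subseteq> set xs \<Longrightarrow> length ys < length xs \<Longrightarrow> \<not> shortcut w ys"
    and w: "\<And>x y. x \<in> mspace Z \<Longrightarrow> y \<in> mspace Z \<Longrightarrow> w x y = mdist Z x y"
    and Z: "hd xs \<in> mspace Z" "last xs \<in> mspace Z" "z \<in> mspace Z" and z: "z \<in> set xs"
  shows "z = hd xs \<or> z = last xs"
proof (rule ccontr)
  assume ne: "\<not> (z = hd xs \<or> z = last xs)"
  obtain us vs where split: "xs = us @ z # vs" using z by (meson split_list)
  then have nonempty: "us \<noteq> []" "vs \<noteq> []" using ne by auto
  then have ends: "hd xs = hd us" "last xs = last vs" by (simp_all add: split)
  have pos: "successively (\<lambda>x y. 0 < w x y) xs" using xs by (simp add: shortcut_def)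
  have "\<not> shortcut w (us @ [z])" "\<not> shortcut w (z # vs)"
    using min[of "us @ [z]"] min[of "z # vs"] nonempty by (auto simp: split)
  then have "w (hd us) z \<le> walk_length w (us @ [z])" "w z (last vs) \<le> walk_length w (z # vs)"
    using pos nonempty by (auto simp: shortcut_def split successively_append_iff)
  then have "w (hd us) z + w z (last vs) \<le> walk_length w xs"
    using walk_length_append[of w us z vs] by (simp add: split)
  moreover have "w (hd us) (last vs) \<le> w (hd us) z + w z (last vs)"
    using Z w mdist_triangle by (simp add: ends)
  ultimately show False using xs by (simp add: shortcut_def ends)
qed

text \<open>The obstacles are the shortcuts on exactly \<open>n\<close> vertices, the fewest that
  can occur. Unwinding deletes edges and keeps the weights of the others, so a shortcut of the new
  graph projects to one of the same length in the old graph. If it has at most \<open>n\<close>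
  vertices, its projection is an obstacle, and the valuations at that obstacle exclude it.\<close>

lemma EPPA_graph_step:
  fixes Z :: "'a metric"
  assumes inf: "infinite (UNIV :: 'a set)" and G: "EPPA_graph Z V w \<alpha>"
    and min: "\<And>xs. set xs \<subseteq> V \<Longrightarrow> length xs < n \<Longrightarrow> \<not> shortcut w xs"
  obtains V' w' \<alpha>' where "EPPA_graph Z V' w' \<alpha>'"
    "\<And>xs. set xs \<subseteq> V' \<Longrightarrow> length xs \<le> n \<Longrightarrow> \<not> shortcut w' xs"
proof -
  note GD = EPPA_graphD[OF G]
  note \<alpha>D = extending_actionD[OF GD(2)]
  have fV: "finite V" using GD(1) .
  define Ms where "Ms = {M. set M \<subseteq> V \<and> length M = n \<and> shortcut w M}"
  have fM: "finite Ms"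
    by (rule finite_subset[OF _ finite_lists_length_eq[OF fV, of n]]) (auto simp: Ms_def)
  have ends: "hd M \<noteq> last M" "M \<noteq> []" if "M \<in> Ms" for M
  proof -
    show M: "M \<noteq> []" using that by (simp add: Ms_def shortcut_def)
    have "successively (\<lambda>x y. 0 \<le> w x y) M"
      using that by (auto simp: Ms_def shortcut_def elim: successively_mono)
    then have "0 < w (hd M) (last M)"
      using that walk_length_nonneg by (fastforce simp: Ms_def shortcut_def)
    moreover have "hd M \<in> V" using that M by (auto simp: Ms_def)
    ultimately show "hd M \<noteq> last M" using GD(3) by force
  qed
  have \<beta>: "coherent_action Z Ms (\<lambda>p. map (\<alpha> p))"
    unfolding coherent_action_def
  proof (intro conjI allI impI ballI funcsetI; (elim conjE)?)
    fix p M assume p: "partial_isometry Z p" and M: "M \<in> Ms"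
    have "w (\<alpha> p x) (\<alpha> p y) = w x y" if "x \<in> set M" "y \<in> set M" for x y
      using that M GD(8)[OF p] by (auto simp: Ms_def)
    then show "map (\<alpha> p) M \<in> Ms"
      using M shortcut_map[of M w "\<alpha> p"] coherent_action_closed[OF \<alpha>D(2) p] by (auto simp: Ms_def)
  next
    fix p M assume "partial_isometry Z p" "p \<subseteq> Id" "M \<in> Ms"
    then show "map (\<alpha> p) M = M"
      using coherent_action_id[OF \<alpha>D(2)] by (intro map_idI) (auto simp: Ms_def)
  next
    fix p q M
    assume "partial_isometry Z p" "partial_isometry Z q" "Range p = Domain q" "M \<in> Ms"
    then show "map (\<alpha> (p O q)) M = map (\<alpha> q) (map (\<alpha> p) M)"
      using coherent_action_comp[OF \<alpha>D(2)] by (auto simp: Ms_def)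
  qed
  \<comment> \<open>A point of \<open>Z\<close> is marked at \<open>M\<close> if \<open>M\<close>
    starts there. Without the condition on the last vertex, a first vertex in \<open>Z\<close> would
    differ from every other point of \<open>Z\<close> on \<open>M\<close> even when the other end
    lies outside \<open>Z\<close>.\<close>
  define \<gamma> where "\<gamma> x = {M \<in> Ms. hd M = x \<and> last M \<in> mspace Z}" for x
  \<comment> \<open>If both ends of \<open>M\<close> lie in \<open>Z\<close>, minimality leaves no
    other point of \<open>Z\<close> on \<open>M\<close>, and exactly one end is marked. If not, no
    point of \<open>Z\<close> is marked at \<open>M\<close>, and two points of \<open>Z\<close>
    cannot be the two ends.\<close>
  have base: "((M \<in> \<gamma> x) \<noteq> (M \<in> \<gamma> y)) \<longleftrightarrow> {x, y} = {hd M, last M}"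
    if M: "M \<in> Ms" and x: "x \<in> mspace Z" "x \<in> set M" and y: "y \<in> mspace Z" "y \<in> set M" and "x \<noteq> y"
    for M x y
  proof -
    have int: "z = hd M \<or> z = last M"
      if "z \<in> {x, y}" "hd M \<in> mspace Z" "last M \<in> mspace Z" for z
    proof (rule minimal_shortcut_interior[of w M Z z])
      show "\<not> shortcut w ys" if "set ys \<subseteq> set M" "length ys < length M" for ys
        using min[of ys] that M by (auto simp: Ms_def)
    qed (use M x y that GD(7) in \<open>auto simp: Ms_def\<close>)
    show ?thesis
      using int[of x] int[of y] M ends[OF M] x y \<open>x \<noteq> y\<close> by (auto simp: \<gamma>_def doubleton_eq_iff)
  qed
  have cons: "((map (\<alpha> p) M \<in> \<gamma> x') \<noteq> (map (\<alpha> p) M \<in> \<gamma> y')) = ((M \<in> \<gamma> x) \<noteq> (M \<in> \<gamma> y))"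
    if p: "partial_isometry Z p" and x: "(x, x') \<in> p" and y: "(y, y') \<in> p" and M: "M \<in> Ms"
      and xy: "x \<in> set M" "y \<in> set M" for p x x' y y' M
  proof (cases "x = y")
    case True
    then show ?thesis using partial_isometry_unique[OF p] x y by blast
  next
    case False
    have ne: "x' \<noteq> y'" using False partial_isometry_inj[OF p] x y by blast
    have \<beta>M: "map (\<alpha> p) M \<in> Ms" using coherent_action_closed[OF \<beta> p M] .
    have \<alpha>xy: "\<alpha> p x = x'" "\<alpha> p y = y'" using \<alpha>D(3)[OF p] x y by auto
    \<comment> \<open>By \<open>base\<close>, being told apart at \<open>M\<close> means being the
      pair of ends of \<open>M\<close>, and injective maps preserve that.\<close>
    have "inj_on (\<alpha> p) (set M)"
      using M coherent_action_inj[OF \<alpha>D(2) p] by (auto simp: inj_on_def Ms_def)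
    then have "{x', y'} = {hd (map (\<alpha> p) M), last (map (\<alpha> p) M)} \<longleftrightarrow> {x, y} = {hd M, last M}"
      using inj_on_image_eq_iff[of "\<alpha> p" "set M" "{x, y}" "{hd M, last M}"] xy ends[OF M]
      by (simp add: hd_map last_map \<alpha>xy)
    moreover have "x' \<in> set (map (\<alpha> p) M)" "y' \<in> set (map (\<alpha> p) M)"
      using xy \<alpha>xy by auto
    ultimately show ?thesis
      using base[OF M _ xy(1) _ xy(2) False] base[OF \<beta>M, of x' y'] ne
        partial_isometry_mspace[OF p x] partial_isometry_mspace[OF p y] by simp
  qed
  have supp_act: "set (map (\<alpha> p) M) = \<alpha> p ` set M" for p M by simp
  have supp_sub: "set M \<subseteq> V" if "M \<in> Ms" for M using that by (simp add: Ms_def)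
  have \<gamma>_sub: "M \<in> Ms \<and> x \<in> set M" if "M \<in> \<gamma> x" for M x
    using that ends(2)[of M] by (auto simp: \<gamma>_def)
  obtain V' \<alpha>' \<pi> val where V': "finite V'" "extending_action Z V' \<alpha>'"
    "\<And>x. x \<in> V' \<Longrightarrow> \<pi> x \<in> V" "\<And>x. x \<in> mspace Z \<Longrightarrow> \<pi> x = x"
    "\<And>x. x \<in> mspace Z \<Longrightarrow> val x = \<gamma> x"
    "\<And>p x. partial_isometry Z p \<Longrightarrow> x \<in> V' \<Longrightarrow> \<pi> (\<alpha>' p x) = \<alpha> p (\<pi> x)"
    "\<And>p x y M. partial_isometry Z p \<Longrightarrow> x \<in> V' \<Longrightarrow> y \<in> V' \<Longrightarrow> M \<in> Ms \<Longrightarrow>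
      \<pi> x \<in> set M \<Longrightarrow> \<pi> y \<in> set M \<Longrightarrow>
      ((map (\<alpha> p) M \<in> val (\<alpha>' p x)) \<noteq> (map (\<alpha> p) M \<in> val (\<alpha>' p y))) = ((M \<in> val x) \<noteq> (M \<in> val y))"
    apply (rule unwinding[where supp = set and \<gamma> = \<gamma>,
          OF inf fV fM GD(2) \<beta> supp_act supp_sub \<gamma>_sub cons]; assumption?)
    subgoal premises prems by (rule prems(1); fact prems)
    done
  note \<alpha>'D = extending_actionD[OF V'(2)]
  \<comment> \<open>The condition concerns all pairs of vertices lying over \<open>M\<close>,
    consecutive or not: their valuations at \<open>M\<close> must differ exactly over the pair of
    ends. An edge survives in \<open>w'\<close> if it passes for every obstacle.\<close>
  define ok where "ok x y M \<longleftrightarrow> \<pi> x \<in> set M \<longrightarrow> \<pi> y \<in> set M \<longrightarrow>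
      ((M \<in> val x) \<noteq> (M \<in> val y)) = ({\<pi> x, \<pi> y} = {hd M, last M})" for x y M
  define w' where "w' x y = (if \<forall>M\<in>Ms. ok x y M then w (\<pi> x) (\<pi> y) else 0)" for x y
  have ok_sym: "ok x y M \<longleftrightarrow> ok y x M" for x y M
    unfolding ok_def insert_commute[of "\<pi> x"] by blast
  have ok_act: "ok (\<alpha>' p x) (\<alpha>' p y) (map (\<alpha> p) M) \<longleftrightarrow> ok x y M"
    if p: "partial_isometry Z p" and x: "x \<in> V'" and y: "y \<in> V'" and M: "M \<in> Ms" for p x y M
  proof -
    have "inj_on (\<alpha> p) V" using coherent_action_inj[OF \<alpha>D(2) p] by (auto simp: inj_on_def)
    note inj = this inj_on_image_mem_iff[OF this] inj_on_image_eq_iff[OF this]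
    have "set M \<subseteq> V" using M by (simp add: Ms_def)
    moreover have "hd M \<in> V" "last M \<in> V" using \<open>set M \<subseteq> V\<close> ends(2)[OF M] by auto
    ultimately have "\<alpha> p (\<pi> x) \<in> \<alpha> p ` set M \<longleftrightarrow> \<pi> x \<in> set M"
      "\<alpha> p (\<pi> y) \<in> \<alpha> p ` set M \<longleftrightarrow> \<pi> y \<in> set M"
      "{\<alpha> p (\<pi> x), \<alpha> p (\<pi> y)} = {\<alpha> p (hd M), \<alpha> p (last M)} \<longleftrightarrow> {\<pi> x, \<pi> y} = {hd M, last M}"
      using inj(2)[of "\<pi> x" "set M"] inj(2)[of "\<pi> y" "set M"]
        inj(3)[of "{\<pi> x, \<pi> y}" "{hd M, last M}"] V'(3)[OF x] V'(3)[OF y]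
      by simp_all
    then show ?thesis
      using V'(7)[OF p x y M] ends(2)[OF M]
      by (simp add: ok_def V'(6)[OF p x] V'(6)[OF p y] hd_map last_map)
  qed
  have ok_act_all: "(\<forall>M\<in>Ms. ok (\<alpha>' p x) (\<alpha>' p y) M) \<longleftrightarrow> (\<forall>M\<in>Ms. ok x y M)"
    if p: "partial_isometry Z p" and x: "x \<in> V'" and y: "y \<in> V'" for p x y
  proof -
    \<comment> \<open>Since \<open>map (\<alpha> p)\<close> permutes the obstacles, a condition on
      all of them can be reindexed through it.\<close>
    have image: "map (\<alpha> p) ` Ms = Ms"
    proof (intro equalityI subsetI)
      fix M assume "M \<in> Ms"
      then show "M \<in> map (\<alpha> p) ` Ms"
        using coherent_action_converse'[OF \<beta> p] coherent_action_closed[OF \<beta> partial_isometry_converse[OF p]]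
        by (metis image_eqI)
    qed (use coherent_action_closed[OF \<beta> p] in auto)
    have "(\<forall>M\<in>map (\<alpha> p) ` Ms. ok (\<alpha>' p x) (\<alpha>' p y) M) \<longleftrightarrow> (\<forall>M\<in>Ms. ok x y M)"
      using ok_act[OF p x y] by simp
    then show ?thesis unfolding image .
  qed
  have "EPPA_graph Z V' w' \<alpha>'"
    unfolding EPPA_graph_def
  proof (intro conjI ballI allI impI)
    show "w' x x = 0" if "x \<in> V'" for x using GD(3)[OF V'(3)[OF that]] by (simp add: w'_def)
    show "w' x y = w' y x" if "x \<in> V'" "y \<in> V'" for x y
      using GD(4)[OF V'(3)[OF that(1)] V'(3)[OF that(2)]] ok_sym[of x y] by (simp add: w'_def)
    show "w' x y \<in> insert 0 (distances Z)" if "x \<in> V'" "y \<in> V'" for x y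
      using GD(5)[OF V'(3)[OF that(1)] V'(3)[OF that(2)]] by (simp add: w'_def)
    show "w' x y = mdist Z x y" if x: "x \<in> mspace Z" and y: "y \<in> mspace Z" for x y
    proof (cases "x = y")
      case True
      then show ?thesis using x \<alpha>D(1) GD(3)[of x] V'(4)[OF x] by (auto simp: w'_def)
    next
      case False
      \<comment> \<open>The marks were chosen so that pairs of points of \<open>Z\<close> pass every
        test; hence no edge of \<open>Z\<close> is deleted.\<close>
      have "ok x y M" if "M \<in> Ms" for M
        using base[OF that x _ y _ False] by (simp add: ok_def V'(4)[OF x] V'(4)[OF y] V'(5)[OF x] V'(5)[OF y])
      then show ?thesis using GD(7)[OF x y] V'(4)[OF x] V'(4)[OF y] by (simp add: w'_def)
    qed
    show "w' (\<alpha>' p x) (\<alpha>' p y) = w' x y" if "partial_isometry Z p" "x \<in> V'" "y \<in> V'" for p x y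
      using ok_act_all[OF that] GD(8)[OF that(1) V'(3)[OF that(2)] V'(3)[OF that(3)]]
      by (simp add: w'_def V'(6)[OF that(1,2)] V'(6)[OF that(1,3)])
  qed (use V' in auto)
  moreover have "\<not> shortcut w' xs" if xs: "set xs \<subseteq> V'" "length xs \<le> n" for xs
  proof
    assume sc: "shortcut w' xs"
    define M where "M = map \<pi> xs"
    have edge: "w (\<pi> x) (\<pi> y) = w' x y" "\<forall>M\<in>Ms. ok x y M" if "0 < w' x y" for x y
      using that by (auto simp: w'_def split: if_splits)
    have ne: "xs \<noteq> []" and pos: "successively (\<lambda>x y. 0 < w' x y) xs"
      and len: "walk_length w' xs < w' (hd xs) (last xs)"
      using sc by (auto simp: shortcut_def)
    have "walk_length w' xs = walk_length w M"
      unfolding M_def walk_length_map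
      by (rule walk_length_cong, rule successively_mono[OF pos]) (simp add: edge(1))
    have "0 \<le> walk_length w' xs"
      by (rule walk_length_nonneg, rule successively_mono[OF pos]) simp
    then have long: "0 < w' (hd xs) (last xs)" using len by simp
    have "successively (\<lambda>x y. 0 < w x y) M"
      unfolding M_def successively_map by (rule successively_mono[OF pos]) (simp add: edge(1))
    then have scM: "shortcut w M"
      using ne len edge(1)[OF long] \<open>walk_length w' xs = walk_length w M\<close>
      by (simp add: shortcut_def M_def hd_map last_map)
    moreover have "set M \<subseteq> V" using xs(1) V'(3) by (auto simp: M_def)
    \<comment> \<open>Fewer than \<open>n\<close> vertices are impossible by minimality, so
      \<open>M\<close> has exactly \<open>n\<close> of them.\<close>
    ultimately have "M \<in> Ms" using min[of M] xs(2) by (force simp: Ms_def M_def)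
    have short: "successively (\<lambda>x y. w x y \<le> walk_length w M) M"
      using scM by (intro edge_le_walk_length) (auto simp: shortcut_def elim: successively_mono)
    \<comment> \<open>An edge of the walk weighs at most as much as the whole walk, hence less than
      the edge joining its ends, so it does not lie over the pair of ends. The valuation at
      \<open>M\<close> is thus constant along the walk, whereas the edge joining its ends requires a
      change.\<close>
    have "successively (\<lambda>x y. (M \<in> val x) = (M \<in> val y)) xs"
    proof (rule successively_mono[OF successively_conj[OF pos short[unfolded M_def successively_map]]])
      fix x y assume x: "x \<in> set xs" and y: "y \<in> set xs"
        and xy: "0 < w' x y \<and> w (\<pi> x) (\<pi> y) \<le> walk_length w (map \<pi> xs)"
      have "w (\<pi> x) (\<pi> y) < w (hd M) (last M)"
        using xy scM by (simp add: shortcut_def flip: M_def)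
      moreover have "w (\<pi> x) (\<pi> y) = w (\<pi> y) (\<pi> x)" using GD(4) V'(3) x y xs(1) by blast
      ultimately have "{\<pi> x, \<pi> y} \<noteq> {hd M, last M}" by (auto simp: doubleton_eq_iff)
      moreover have "\<pi> x \<in> set M" "\<pi> y \<in> set M" using x y by (auto simp: M_def)
      ultimately show "(M \<in> val x) = (M \<in> val y)"
        using edge(2) xy \<open>M \<in> Ms\<close> by (auto simp: ok_def)
    qed
    then have "(M \<in> val (last xs)) = (M \<in> val (hd xs))" using ne by (rule successively_eq_hd_last)
    moreover have "ok (hd xs) (last xs) M" using edge(2)[OF long] \<open>M \<in> Ms\<close> by blast
    ultimately show False using ne by (auto simp: ok_def M_def hd_map last_map)
  qed
  ultimately show thesis by (rule that)
qed

text \<open>All weights stay among the finitely many distances of \<open>Z\<close> through every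
  round. A single bound therefore serves all graphs: a walk with enough edges is longer than the
  largest distance and cannot be a shortcut.\<close>

lemma EPPA_graph_without_shortcuts:
  fixes Z :: "'a metric"
  assumes inf: "infinite (UNIV :: 'a set)" and fZ: "finite (mspace Z)"
  obtains V w \<alpha> where "EPPA_graph Z V w \<alpha>" "\<And>xs. set xs \<subseteq> V \<Longrightarrow> \<not> shortcut w xs"
proof -
  have stage: "\<exists>V w \<alpha>. EPPA_graph Z V w \<alpha> \<and> (\<forall>xs. set xs \<subseteq> V \<longrightarrow> length xs < n \<longrightarrow> \<not> shortcut w xs)" for n
  proof (induction n)
    case 0
    show ?case using EPPA_graph_exists[OF inf fZ] by blast
  next
    case (Suc n)
    then obtain V w \<alpha> where "EPPA_graph Z V w \<alpha>"
      and "\<And>xs. set xs \<subseteq> V \<Longrightarrow> length xs < n \<Longrightarrow> \<not> shortcut w xs" by blast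
    from EPPA_graph_step[OF inf this]
    obtain V' w' \<alpha>' where "EPPA_graph Z V' w' \<alpha>'"
      "\<And>xs. set xs \<subseteq> V' \<Longrightarrow> length xs \<le> n \<Longrightarrow> \<not> shortcut w' xs" by blast
    then show ?case by (auto simp: less_Suc_eq_le)
  qed
  have fD: "finite (distances Z)" using fZ by (simp add: distances_def)
  \<comment> \<open>The extra 1 covers a space with at most one point, which has no positive
    distance.\<close>
  define \<delta> where "\<delta> = Min (insert 1 (distances Z \<inter> {0<..}))"
  have \<delta>: "0 < \<delta>" "\<And>t. t \<in> distances Z \<Longrightarrow> 0 < t \<Longrightarrow> \<delta> \<le> t"
    using fD by (auto simp: \<delta>_def)
  define D where "D = Max (insert 0 (distances Z))"
  have D: "t \<le> D" if "t \<in> insert 0 (distances Z)" for t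
    unfolding D_def using fD that by (intro Max_ge) auto
  obtain n :: nat where n: "D < real n * \<delta>" using \<delta>(1) reals_Archimedean3 by blast
  \<comment> \<open>At stage \<open>Suc n\<close> a shortcut would have more than \<open>n\<close>
    vertices, hence at least \<open>n\<close> edges, each of weight at least
    \<open>\<delta>\<close>.\<close>
  obtain V w \<alpha> where G: "EPPA_graph Z V w \<alpha>"
    and min: "\<And>xs. set xs \<subseteq> V \<Longrightarrow> length xs < Suc n \<Longrightarrow> \<not> shortcut w xs" using stage by blast
  have "\<not> shortcut w xs" if xs: "set xs \<subseteq> V" for xs
  proof
    assume sc: "shortcut w xs"
    then have ne: "xs \<noteq> []" by (simp add: shortcut_def)
    have "\<not> length xs < Suc n" using min[OF xs] sc by blast
    then have long: "n \<le> length xs - 1" by simp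
    have "successively (\<lambda>x y. \<delta> \<le> w x y) xs"
    proof (rule successively_mono)
      show "successively (\<lambda>x y. 0 < w x y) xs" using sc by (simp add: shortcut_def)
      show "\<delta> \<le> w x y" if "0 < w x y" "x \<in> set xs" "y \<in> set xs" for x y
        using EPPA_graphD(5)[OF G, of x y] \<delta>(2)[of "w x y"] that xs by auto
    qed
    then have "(real (length xs) - 1) * \<delta> \<le> walk_length w xs" using ne by (rule walk_length_ge)
    moreover have "real n * \<delta> \<le> (real (length xs) - 1) * \<delta>"
      using long ne \<delta>(1) by (intro mult_right_mono) (auto simp: Suc_le_eq less_eq_Suc_le neq_Nil_conv)
    moreover have "w (hd xs) (last xs) \<le> D"
      using xs ne by (intro D EPPA_graphD(5)[OF G]) auto
    ultimately show False using sc n by (simp add: shortcut_def)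
  qed
  with G show thesis by (rule that)
qed


subsection \<open>Path metrics and amalgams\<close>

text \<open>Missing edges receive the weight \<open>c\<close>, which bounds every weight, so a walk
  using one is already long enough. Any other walk becomes a walk along genuine edges once its steps
  of length 0 are dropped, and then the absence of shortcuts applies.\<close>

lemma edge_le_walk_length_completed:
  fixes w :: "'a \<Rightarrow> 'a \<Rightarrow> real"
  assumes no: "\<And>xs. set xs \<subseteq> V \<Longrightarrow> \<not> shortcut w xs"
    and c: "\<And>x y. x \<in> V \<Longrightarrow> y \<in> V \<Longrightarrow> w x y \<le> c" "0 \<le> c"
    and xs: "set xs \<subseteq> V" "xs \<noteq> []"
  shows "w (hd xs) (last xs) \<le>
    walk_length (\<lambda>x y. if x = y then 0 else if 0 < w x y then w x y else c) xs"
proof -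
  let ?v = "\<lambda>x y. if x = y then 0 else if 0 < w x y then w x y else c"
  have v: "0 \<le> ?v x y" for x y using c(2) by simp
  have nonneg: "0 \<le> walk_length ?v xs" for xs
    using v by (intro walk_length_nonneg) (induction xs rule: induct_list012; auto)
  have "c \<le> walk_length ?v xs \<or> (\<exists>ys. set ys \<subseteq> set xs \<and> ys \<noteq> [] \<and> hd ys = hd xs \<and> last ys = last xs \<and>
      successively (\<lambda>x y. 0 < w x y) ys \<and> walk_length w ys \<le> walk_length ?v xs)"
    using xs(2)
  proof (induction xs rule: induct_list012)
    case (2 x)
    then show ?case by (intro disjI2 exI[of _ "[x]"]) simp
  next
    case (3 x y zs)
    have wl: "walk_length ?v (x # y # zs) = ?v x y + walk_length ?v (y # zs)" by simp
    show ?case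
    proof (cases "c \<le> walk_length ?v (y # zs) \<or> (x \<noteq> y \<and> \<not> 0 < w x y)")
      case True
      then show ?thesis using v[of x y] nonneg[of "y # zs"] wl by auto
    next
      case False
      then obtain ys where ys: "set ys \<subseteq> set (y # zs)" "ys \<noteq> []" "hd ys = y" "last ys = last (y # zs)"
        "successively (\<lambda>x y. 0 < w x y) ys" "walk_length w ys \<le> walk_length ?v (y # zs)"
        using "3.IH"(2) by auto
      obtain ys' where ys': "ys = y # ys'" using ys(2,3) by (cases ys) auto
      show ?thesis
      proof (cases "x = y")
        case True
        then show ?thesis using ys by (intro disjI2 exI[of _ ys]) auto
      next
        case ne: False
        then show ?thesis using ys False unfolding ys' by (intro disjI2 exI[of _ "x # y # ys'"]) auto
      qed
    qed
  qed simp
  then show ?thesis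
  proof (elim disjE exE conjE)
    assume "c \<le> walk_length ?v xs"
    moreover have "w (hd xs) (last xs) \<le> c" using xs by (intro c(1)) auto
    ultimately show ?thesis by simp
  next
    fix ys
    assume "set ys \<subseteq> set xs" "ys \<noteq> []" "hd ys = hd xs" "last ys = last xs"
      "successively (\<lambda>x y. 0 < w x y) ys" "walk_length w ys \<le> walk_length ?v xs"
    moreover from this have "\<not> shortcut w ys" using no[of ys] xs(1) by blast
    ultimately show ?thesis by (simp add: shortcut_def)
  qed
qed

text \<open>The distance is the infimum of the lengths of walks after every missing edge has been
  filled in, so that any two vertices are joined. Without shortcuts no walk undercuts an edge, and
  so the distances of \<open>Z\<close> are kept.\<close>

lemma path_metric:
  fixes Z :: "'a metric"
  assumes fZ: "finite (mspace Z)" and G: "EPPA_graph Z V w \<alpha>"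
    and no: "\<And>xs. set xs \<subseteq> V \<Longrightarrow> \<not> shortcut w xs"
  obtains Y where "mspace Y = V" "metric_extends Y Z"
    "\<And>p x y. partial_isometry Z p \<Longrightarrow> x \<in> V \<Longrightarrow> y \<in> V \<Longrightarrow> mdist Y (\<alpha> p x) (\<alpha> p y) = mdist Y x y"
proof -
  note GD = EPPA_graphD[OF G]
  note \<alpha>D = extending_actionD[OF GD(2)]
  have fD: "finite (insert 1 (distances Z))" using fZ by (simp add: distances_def)
  \<comment> \<open>The 1 keeps \<open>c\<close> positive even if \<open>Z\<close> has no positive
    distance, so distinct vertices always get a positive weight.\<close>
  define c where "c = Max (insert 1 (distances Z))"
  have c1: "1 \<le> c" unfolding c_def using fD by (intro Max_ge) auto
  have c: "w x y \<le> c" if "x \<in> V" "y \<in> V" for x y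
  proof (cases "w x y = 0")
    case False
    then have "w x y \<in> insert 1 (distances Z)" using GD(5)[OF that] by blast
    then show ?thesis unfolding c_def using fD by (rule Max_ge[rotated])
  qed (use c1 in simp)
  define v where "v x y = (if x = y then 0 else if 0 < w x y then w x y else c)" for x y
  have v_nonneg: "0 \<le> v x y" for x y using c1 by (simp add: v_def)
  have len_nonneg: "0 \<le> walk_length v xs" for xs
    using v_nonneg by (intro walk_length_nonneg) (induction xs rule: induct_list012; auto)
  define W where "W x y = {xs. set xs \<subseteq> V \<and> xs \<noteq> [] \<and> hd xs = x \<and> last xs = y}" for x y
  have W_edge: "[x, y] \<in> W x y" if "x \<in> V" "y \<in> V" for x y using that by (simp add: W_def)
  \<comment> \<open>With the value 0 outside \<open>V\<close>, nonnegativity and symmetry hold for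
    all arguments, as \<open>Metric_space\<close> demands.\<close>
  define \<rho> where "\<rho> x y = (if x \<in> V \<and> y \<in> V then INF xs\<in>W x y. walk_length v xs else 0)" for x y
  have \<rho>_le: "\<rho> x y \<le> walk_length v xs" if "xs \<in> W x y" for x y xs
  proof -
    have "x \<in> V" "y \<in> V" using that by (auto simp: W_def)
    moreover have "bdd_below (walk_length v ` W x y)" using len_nonneg by (intro bdd_belowI2)
    ultimately show ?thesis using that by (simp add: \<rho>_def cINF_lower)
  qed
  have \<rho>_ge: "b \<le> \<rho> x y"
    if "x \<in> V" "y \<in> V" "\<And>xs. xs \<in> W x y \<Longrightarrow> b \<le> walk_length v xs" for x y b
    using that W_edge[OF that(1,2)] by (auto simp: \<rho>_def intro: cINF_greatest)
  have \<rho>_nonneg: "0 \<le> \<rho> x y" for x y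
    using \<rho>_ge[of x y 0] len_nonneg by (cases "x \<in> V \<and> y \<in> V") (auto simp: \<rho>_def)
  have \<rho>_sym: "\<rho> x y \<le> \<rho> y x" for x y
  proof (cases "x \<in> V \<and> y \<in> V")
    case True
    show ?thesis
    proof (rule \<rho>_ge)
      fix xs assume xs: "xs \<in> W y x"
      then have "rev xs \<in> W x y" by (auto simp: W_def hd_rev last_rev)
      moreover have "successively (\<lambda>x y. v y x = v x y) xs"
      proof (rule successively_mono[of "\<lambda>_ _. True"])
        show "successively (\<lambda>_ _. True) xs" by (induction xs rule: induct_list012) auto
        show "v b a = v a b" if "a \<in> set xs" "b \<in> set xs" for a b
        proof -
          have "a \<in> V" "b \<in> V" using that xs by (auto simp: W_def)
          then show ?thesis using GD(4)[of a b] by (simp add: v_def)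
        qed
      qed
      ultimately show "\<rho> x y \<le> walk_length v xs"
        using \<rho>_le walk_length_cong by (fastforce simp: walk_length_rev)
    qed (use True in auto)
  qed (auto simp: \<rho>_def)
  have \<rho>_triangle: "\<rho> x z \<le> \<rho> x y + \<rho> y z" if x: "x \<in> V" and y: "y \<in> V" and z: "z \<in> V" for x y z
  proof -
    have two: "\<rho> x z \<le> walk_length v xs + walk_length v ys" if xs: "xs \<in> W x y" and ys: "ys \<in> W y z" for xs ys
    proof -
      obtain xs' where xs': "xs = xs' @ [y]"
        by (rule that[of "butlast xs"]) (use xs in \<open>auto simp: W_def\<close>)
      obtain ys' where ys': "ys = y # ys'"
        by (rule that[of "tl ys"]) (use ys in \<open>auto simp: W_def\<close>)
      have "xs' @ y # ys' \<in> W x z"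
        using xs ys by (auto simp: W_def xs' ys' hd_append split: if_splits)
      then show ?thesis
        using \<rho>_le[of "xs' @ y # ys'" x z] walk_length_append[of v xs' y ys'] by (simp add: xs' ys')
    qed
    have "\<rho> x z - walk_length v xs \<le> \<rho> y z" if "xs \<in> W x y" for xs
    proof (rule \<rho>_ge[OF y z])
      show "\<rho> x z - walk_length v xs \<le> walk_length v ys" if "ys \<in> W y z" for ys
        using two[OF \<open>xs \<in> W x y\<close> that] by simp
    qed
    then have "\<rho> x z - \<rho> y z \<le> \<rho> x y"
      by (intro \<rho>_ge x y) (simp add: algebra_simps)
    then show ?thesis by simp
  qed
  have \<rho>_zero: "\<rho> x y = 0 \<longleftrightarrow> x = y" if x: "x \<in> V" and y: "y \<in> V" for x y
  proof
    assume "x = y"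
    moreover have "[x] \<in> W x x" using x by (simp add: W_def)
    ultimately show "\<rho> x y = 0" using \<rho>_le[of "[x]" x x] \<rho>_nonneg[of x x] by simp
  next
    assume 0: "\<rho> x y = 0"
    show "x = y"
    proof (rule ccontr)
      assume ne: "x \<noteq> y"
      \<comment> \<open>As \<open>V\<close> is finite, there is a least positive completed weight.
        It bounds the lengths of all walks between distinct vertices from below, so their infimum is
        positive.\<close>
      define \<delta> where "\<delta> = Min (insert 1 ((\<lambda>(x, y). v x y) ` (V \<times> V) \<inter> {0<..}))"
      have fin: "finite (insert 1 ((\<lambda>(x, y). v x y) ` (V \<times> V) \<inter> {0<..}))" using GD(1) by simp
      have \<delta>0: "0 < \<delta>" using fin by (simp add: \<delta>_def)
      have \<delta>: "\<delta> \<le> v a b" if "a \<in> V" "b \<in> V" "a \<noteq> b" for a b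
      proof -
        have "0 < v a b" using that c1 by (simp add: v_def)
        moreover have "v a b \<in> (\<lambda>(x, y). v x y) ` (V \<times> V)"
          using that by (intro image_eqI[of _ _ "(a, b)"]) auto
        ultimately show ?thesis unfolding \<delta>_def using fin by (intro Min_le) simp_all
      qed
      have "hd xs = last xs \<or> \<delta> \<le> walk_length v xs" if "set xs \<subseteq> V" "xs \<noteq> []" for xs
        using that
      proof (induction xs rule: induct_list012)
        case (3 a b xs)
        have "walk_length v (a # b # xs) = v a b + walk_length v (b # xs)" by simp
        then show ?case
          using 3 \<delta>[of a b] v_nonneg[of a b] len_nonneg[of "b # xs"] by (cases "a = b") auto
      qed auto
      then have "\<delta> \<le> \<rho> x y" using ne by (intro \<rho>_ge x y) (auto simp: W_def)
      then show False using 0 \<delta>0 by simp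
    qed
  qed
  have \<rho>_act_le: "\<rho> (\<alpha> p x) (\<alpha> p y) \<le> \<rho> x y"
    if p: "partial_isometry Z p" and x: "x \<in> V" and y: "y \<in> V" for p x y
  proof (rule \<rho>_ge[OF x y])
    fix xs assume xs: "xs \<in> W x y"
    have "map (\<alpha> p) xs \<in> W (\<alpha> p x) (\<alpha> p y)"
      using xs coherent_action_closed[OF \<alpha>D(2) p] by (auto simp: W_def hd_map last_map)
    moreover have "successively (\<lambda>x y. v (\<alpha> p x) (\<alpha> p y) = v x y) xs"
    proof (rule successively_mono[of "\<lambda>_ _. True"])
      show "successively (\<lambda>_ _. True) xs" by (induction xs rule: induct_list012) auto
      show "v (\<alpha> p a) (\<alpha> p b) = v a b" if "a \<in> set xs" "b \<in> set xs" for a b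
      proof -
        have "a \<in> V" "b \<in> V" using that xs by (auto simp: W_def)
        then show ?thesis
          using GD(8)[OF p] coherent_action_inj[OF \<alpha>D(2) p] by (auto simp: v_def)
      qed
    qed
    ultimately show "\<rho> (\<alpha> p x) (\<alpha> p y) \<le> walk_length v xs"
      using \<rho>_le walk_length_cong by (fastforce simp: walk_length_map)
  qed
  \<comment> \<open>The reverse inequality is the previous one for the converse of
    \<open>p\<close>.\<close>
  have \<rho>_act: "\<rho> (\<alpha> p x) (\<alpha> p y) = \<rho> x y" if p: "partial_isometry Z p" and x: "x \<in> V" and y: "y \<in> V" for p x y
    using \<rho>_act_le[OF that] \<rho>_act_le[OF partial_isometry_converse[OF p], of "\<alpha> p x" "\<alpha> p y"]
      coherent_action_closed[OF \<alpha>D(2) p] coherent_action_converse[OF \<alpha>D(2) p] x y by simp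
  have \<rho>_Z: "\<rho> x y = mdist Z x y" if x: "x \<in> mspace Z" and y: "y \<in> mspace Z" for x y
  proof (cases "x = y")
    case True
    then show ?thesis using x \<alpha>D(1) \<rho>_zero[of x y] by auto
  next
    case False
    have xyV: "x \<in> V" "y \<in> V" using x y \<alpha>D(1) by auto
    have "w x y \<le> \<rho> x y"
    proof (rule \<rho>_ge[OF xyV])
      show "w x y \<le> walk_length v xs" if "xs \<in> W x y" for xs
        using edge_le_walk_length_completed[of V w c xs] no c c1 that
        by (auto simp: W_def v_def[abs_def])
    qed
    moreover have "0 < w x y" using False GD(7)[OF x y] x y by (simp add: order_less_le)
    then have "\<rho> x y \<le> w x y" using \<rho>_le[OF W_edge[OF xyV]] False by (simp add: v_def)
    ultimately show ?thesis using GD(7)[OF x y] by simp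
  qed
  have M: "Metric_space V \<rho>"
    by unfold_locales (use \<rho>_nonneg \<rho>_zero \<rho>_triangle \<rho>_sym in \<open>auto intro: antisym\<close>)
  show thesis
  proof (rule that[of "metric (V, \<rho>)"])
    show "mspace (metric (V, \<rho>)) = V" using M by (simp add: Metric_space.mspace_metric)
    show "metric_extends (metric (V, \<rho>)) Z"
      using M \<alpha>D(1) \<rho>_Z by (simp add: metric_extends_def Metric_space.mspace_metric Metric_space.mdist_metric)
    show "mdist (metric (V, \<rho>)) (\<alpha> p x) (\<alpha> p y) = mdist (metric (V, \<rho>)) x y"
      if "partial_isometry Z p" "x \<in> V" "y \<in> V" for p x y
      using M \<rho>_act[OF that] by (simp add: Metric_space.mdist_metric)
  qed
qed

lemma coherent_EPPA:
  fixes Z :: "'a metric"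
  assumes "infinite (UNIV :: 'a set)" "finite (mspace Z)"
  obtains Y \<alpha> where "finite (mspace Y)" "metric_extends Y Z" "extending_action Z (mspace Y) \<alpha>"
    "\<And>p x y. partial_isometry Z p \<Longrightarrow> x \<in> mspace Y \<Longrightarrow> y \<in> mspace Y \<Longrightarrow>
      mdist Y (\<alpha> p x) (\<alpha> p y) = mdist Y x y"
proof -
  obtain V w \<alpha> where G: "EPPA_graph Z V w \<alpha>" and no: "\<And>xs. set xs \<subseteq> V \<Longrightarrow> \<not> shortcut w xs"
    using EPPA_graph_without_shortcuts[OF assms] by blast
  from path_metric[OF assms(2) G no]
  obtain Y where "mspace Y = V" "metric_extends Y Z"
    "\<And>p x y. partial_isometry Z p \<Longrightarrow> x \<in> V \<Longrightarrow> y \<in> V \<Longrightarrow> mdist Y (\<alpha> p x) (\<alpha> p y) = mdist Y x y"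
    by blast
  then show thesis using that[of Y \<alpha>] EPPA_graphD(1,2)[OF G] by simp
qed

section \<open>Amalgamation of metric spaces over a finite common part\<close>

text \<open>The distance between the two sides is the shortest detour through the common part. As
  this part is finite and nonempty, the minimum is attained; this gives the triangle inequalities
  and positivity.\<close>

lemma metric_amalgam:
  fixes A B :: "'a metric"
  assumes fin: "finite (mspace A \<inter> mspace B)" and ne: "mspace A \<inter> mspace B \<noteq> {}"
    and agree: "\<And>x y. x \<in> mspace A \<inter> mspace B \<Longrightarrow> y \<in> mspace A \<inter> mspace B \<Longrightarrow> mdist A x y = mdist B x y"
  obtains Z where "mspace Z = mspace A \<union> mspace B" "metric_extends Z A" "metric_extends Z B"
proof -
  let ?A = "mspace A" and ?B = "mspace B"
  define cr where "cr x y = Min ((\<lambda>z. mdist A x z + mdist B z y) ` (?A \<inter> ?B))" for x y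
  have cr_le: "cr x y \<le> mdist A x z + mdist B z y" if "z \<in> ?A" "z \<in> ?B" for x y z
    unfolding cr_def using fin that by (intro Min_le) auto
  have cr_ex: "\<exists>z\<in>?A \<inter> ?B. cr x y = mdist A x z + mdist B z y" for x y
  proof -
    have "cr x y \<in> (\<lambda>z. mdist A x z + mdist B z y) ` (?A \<inter> ?B)"
      unfolding cr_def using fin ne by (intro Min_in) auto
    then show ?thesis by blast
  qed
  define d where "d x y = (if x \<in> ?A \<and> y \<in> ?A then mdist A x y
      else if x \<in> ?B \<and> y \<in> ?B then mdist B x y
      else if x \<in> ?A \<and> y \<in> ?B then cr x y
      else if x \<in> ?B \<and> y \<in> ?A then cr y x else 0)" for x y
  have dA: "d x y = mdist A x y" if "x \<in> ?A" "y \<in> ?A" for x y using that by (simp add: d_def)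
  have dB: "d x y = mdist B x y" if "x \<in> ?B" "y \<in> ?B" for x y
    using that agree by (auto simp: d_def)
  have d_sym: "d x y = d y x" for x y
    by (cases "x \<in> ?A"; cases "y \<in> ?A"; cases "x \<in> ?B"; cases "y \<in> ?B")
      (simp_all add: d_def mdist_commute[of _ x y])
  have cross_le: "d x y \<le> d x z + d z y" if "x \<in> ?A" "y \<in> ?B" "z \<in> ?A" "z \<in> ?B" for x y z
  proof (cases "x \<in> ?B \<or> y \<in> ?A")
    case True
    then show ?thesis
      using that mdist_triangle[of x A z y] mdist_triangle[of x B z y]
        dA[of x y] dA[of x z] dA[of z y] dB[of x y] dB[of x z] dB[of z y] by auto
  next
    case False
    then show ?thesis using that cr_le[of z x y] dA[of x z] dB[of z y] by (simp add: d_def[of x y])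
  qed
  \<comment> \<open>A point that already lies in both spaces serves as its own crossing
    point.\<close>
  have cross_ex: "\<exists>z\<in>?A \<inter> ?B. d x y = d x z + d z y" if "x \<in> ?A" "y \<in> ?B" for x y
  proof (cases "x \<in> ?B \<or> y \<in> ?A")
    case True
    then show ?thesis
    proof
      assume "x \<in> ?B"
      then show ?thesis using that by (intro bexI[of _ x]) (auto simp: dA)
    next
      assume "y \<in> ?A"
      then show ?thesis using that by (intro bexI[of _ y]) (auto simp: dA)
    qed
  next
    case False
    obtain z where "z \<in> ?A \<inter> ?B" "cr x y = mdist A x z + mdist B z y" using cr_ex by blast
    then show ?thesis using that False dA[of x z] dB[of z y] by (intro bexI[of _ z]) (auto simp: d_def[of x y])
  qed
  have triA: "d x y \<le> d x z + d z y" if "x \<in> ?A" "y \<in> ?A" "z \<in> ?A" for x y z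
    using that mdist_triangle by (simp add: dA)
  have triB: "d x y \<le> d x z + d z y" if "x \<in> ?B" "y \<in> ?B" "z \<in> ?B" for x y z
    using that mdist_triangle by (simp add: dB)
  \<comment> \<open>A detour from \<open>A\<close> into \<open>B\<close> crosses the common part at
    \<open>z\<close> and again at \<open>z'\<close>. The piece between them can be shortened inside
    \<open>B\<close>, and what remains is a path inside \<open>A\<close>.\<close>
  have AAB: "d x y \<le> d x u + d u y" if x: "x \<in> ?A" and y: "y \<in> ?A" and u: "u \<in> ?B" for x y u
  proof -
    obtain z z' where z: "z \<in> ?A \<inter> ?B" "d x u = d x z + d z u" and z': "z' \<in> ?A \<inter> ?B" "d y u = d y z' + d z' u"
      using cross_ex[OF x u] cross_ex[OF y u] by blast
    have "d x y \<le> d x z + d z y" "d z y \<le> d z z' + d z' y" "d z z' \<le> d z u + d u z'"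
      using triA triB x y u z(1) z'(1) by blast+
    then show ?thesis using z(2) z'(2) d_sym[of u y] d_sym[of y z'] d_sym[of z' u] by linarith
  qed
  have BBA: "d x y \<le> d x u + d u y" if x: "x \<in> ?B" and y: "y \<in> ?B" and u: "u \<in> ?A" for x y u
  proof -
    obtain z z' where z: "z \<in> ?A \<inter> ?B" "d u x = d u z + d z x" and z': "z' \<in> ?A \<inter> ?B" "d u y = d u z' + d z' y"
      using cross_ex[OF u x] cross_ex[OF u y] by blast
    have "d x y \<le> d x z + d z y" "d z y \<le> d z z' + d z' y" "d z z' \<le> d z u + d u z'"
      using triA triB x y u z(1) z'(1) by blast+
    then show ?thesis using z(2) z'(2) d_sym[of u x] d_sym[of u z] d_sym[of x z] by linarith
  qed
  have AB: "d x y \<le> d x u + d u y" if x: "x \<in> ?A" and y: "y \<in> ?B" and u: "u \<in> ?A \<union> ?B" for x y u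
  proof (cases "u \<in> ?A")
    case True
    obtain z where z: "z \<in> ?A \<inter> ?B" "d u y = d u z + d z y" using cross_ex[OF True y] by blast
    have "d x y \<le> d x z + d z y" "d x z \<le> d x u + d u z"
      using triA cross_le x y True z(1) by blast+
    then show ?thesis using z(2) by linarith
  next
    case False
    then have uB: "u \<in> ?B" using u by blast
    obtain z where z: "z \<in> ?A \<inter> ?B" "d x u = d x z + d z u" using cross_ex[OF x uB] by blast
    have "d x y \<le> d x z + d z y" "d z y \<le> d z u + d u y"
      using triB cross_le x y uB z(1) by blast+
    then show ?thesis using z(2) by linarith
  qed
  have d_nonneg: "0 \<le> d x y" for x y
  proof -
    have "0 \<le> cr x y" for x y using cr_ex[of x y] by auto
    then show ?thesis by (simp add: d_def)
  qed
  have d_triangle: "d x y \<le> d x u + d u y" if "x \<in> ?A \<union> ?B" "u \<in> ?A \<union> ?B" "y \<in> ?A \<union> ?B" for x y u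
  proof -
    have BA: "d x y \<le> d x u + d u y" if x: "x \<in> ?B" and y: "y \<in> ?A"
      using AB[OF y x \<open>u \<in> ?A \<union> ?B\<close>] d_sym[of x y] d_sym[of x u] d_sym[of u y] by simp
    show ?thesis using that triA triB AAB BBA AB BA by blast
  qed
  have d_zero: "d x y = 0 \<longleftrightarrow> x = y" if "x \<in> ?A \<union> ?B" "y \<in> ?A \<union> ?B" for x y
  proof -
    \<comment> \<open>At a crossing point attaining the minimum both summands vanish, so it equals
      \<open>x\<close> and \<open>y\<close>.\<close>
    have *: "x = y" if x: "x \<in> ?A" and y: "y \<in> ?B" and 0: "d x y = 0" for x y
    proof -
      obtain z where z: "z \<in> ?A \<inter> ?B" "d x y = d x z + d z y" using cross_ex[OF x y] by blast
      then have "d x z = 0" "d z y = 0" using 0 d_nonneg[of x z] d_nonneg[of z y] by linarith+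
      then show ?thesis using z(1) x y by (simp add: dA dB)
    qed
    have "x = y" if "d x y = 0"
      using *[of x y] *[of y x] that d_sym[of x y] \<open>x \<in> ?A \<union> ?B\<close> \<open>y \<in> ?A \<union> ?B\<close> dA[of x y] dB[of x y]
      by (auto simp del: Un_iff dest: UnE)
    moreover have "d x x = 0" using \<open>x \<in> ?A \<union> ?B\<close> dA[of x x] dB[of x x] by auto
    ultimately show ?thesis by auto
  qed
  have M: "Metric_space (?A \<union> ?B) d"
    by unfold_locales (use d_nonneg d_sym d_zero d_triangle in \<open>blast+\<close>)
  show thesis
    by (rule that[of "metric (?A \<union> ?B, d)"])
      (use M dA dB in \<open>auto simp: metric_extends_def Metric_space.mspace_metric Metric_space.mdist_metric\<close>)
qed


subsection \<open>Minimal S-extensions\<close>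

lemma carrier_Iso: "carrier (Iso Y) = isometries Y"
  by (simp add: Iso_def)

lemma isometries_closed: "f \<in> isometries Y \<Longrightarrow> x \<in> mspace Y \<Longrightarrow> f x \<in> mspace Y"
  by (auto simp: isometries_def dest!: Bij_imp_funcset)

lemma isometries_extensional: "f \<in> isometries Y \<Longrightarrow> f \<in> extensional (mspace Y)"
  by (auto simp: isometries_def Bij_def)

lemma one_Iso: "\<one>\<^bsub>Iso Y\<^esub> = (\<lambda>x\<in>mspace Y. x)"
  by (simp add: Iso_def BijGroup_def)

lemma mult_Iso:
  "f \<in> isometries Y \<Longrightarrow> g \<in> isometries Y \<Longrightarrow> f \<otimes>\<^bsub>Iso Y\<^esub> g = compose (mspace Y) f g"
  by (simp add: Iso_def BijGroup_def isometries_def)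

text \<open>This provides at once the two requirements that an S-extension places on the maps
  assigned to \<open>p\<close> and its converse: being isometries and being inverse in the
  group.\<close>

lemma Iso_inverse_pair:
  assumes "f \<in> extensional (mspace Y)" "g \<in> extensional (mspace Y)"
    and f: "\<And>x. x \<in> mspace Y \<Longrightarrow> f x \<in> mspace Y" "\<And>x. x \<in> mspace Y \<Longrightarrow> g (f x) = x"
    and g: "\<And>x. x \<in> mspace Y \<Longrightarrow> g x \<in> mspace Y" "\<And>x. x \<in> mspace Y \<Longrightarrow> f (g x) = x"
    and d: "\<And>x y. x \<in> mspace Y \<Longrightarrow> y \<in> mspace Y \<Longrightarrow> mdist Y (f x) (f y) = mdist Y x y"
  shows "f \<in> isometries Y" "g = inv\<^bsub>Iso Y\<^esub> f"
proof -
  have "bij_betw f (mspace Y) (mspace Y)"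
    by (rule bij_betw_byWitness[where f' = g]) (use f g in auto)
  moreover have "bij_betw g (mspace Y) (mspace Y)"
    by (rule bij_betw_byWitness[where f' = f]) (use f g in auto)
  moreover have "mdist Y (g x) (g y) = mdist Y x y" if "x \<in> mspace Y" "y \<in> mspace Y" for x y
    using d[of "g x" "g y"] g that by simp
  ultimately have fI: "f \<in> isometries Y" and gI: "g \<in> isometries Y"
    using assms by (auto simp: isometries_def Bij_def)
  show "f \<in> isometries Y" by (rule fI)
  interpret group "Iso Y" by (rule group_Iso)
  have "g \<otimes>\<^bsub>Iso Y\<^esub> f = \<one>\<^bsub>Iso Y\<^esub>"
    using fI gI f(2) by (simp add: mult_Iso one_Iso compose_def cong: restrict_cong)
  then show "g = inv\<^bsub>Iso Y\<^esub> f"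
    using inv_equality fI gI by (simp add: carrier_Iso)
qed

lemma S_extensionD:
  assumes "S_extension X P Y \<phi>"
  shows "metric_extends Y X" "p \<in> P \<Longrightarrow> \<phi> p \<in> isometries Y"
    "p \<in> P \<Longrightarrow> (x, y) \<in> p \<Longrightarrow> \<phi> p x = y" "p \<in> P \<Longrightarrow> \<phi> (p\<inverse>) = inv\<^bsub>Iso Y\<^esub> \<phi> p"
  using assms by (auto simp: S_extension_def carrier_Iso)

lemma word_eval_Cons: "word_eval G f (p # w) = f p \<otimes>\<^bsub>G\<^esub> word_eval G f w"
  by (simp add: word_eval_def)

lemma word_eval_Nil: "word_eval G f [] = \<one>\<^bsub>G\<^esub>"
  by (simp add: word_eval_def)

context
  fixes X Y :: "'a metric" and P :: "('a \<times> 'a) set set" and \<phi>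
  assumes S: "S_extension X P Y \<phi>" and P: "converse ` P = P"
begin

private abbreviation "ev \<equiv> word_eval (Iso Y) \<phi>"

lemma S_extension_word_closed: "w \<in> lists P \<Longrightarrow> ev w \<in> isometries Y"
  unfolding carrier_Iso[symmetric]
  by (rule word_eval_closed[OF group_Iso P]) (use S in \<open>auto simp: S_extension_def\<close>)

lemma S_extension_word_Cons:
  "p \<in> P \<Longrightarrow> w \<in> lists P \<Longrightarrow> y \<in> mspace Y \<Longrightarrow> ev (p # w) y = \<phi> p (ev w y)"
  using S_extensionD(2)[OF S] S_extension_word_closed
  by (simp add: word_eval_Cons mult_Iso compose_eq)

lemma S_extension_word_append:
  "u \<in> lists P \<Longrightarrow> v \<in> lists P \<Longrightarrow> ev (u @ v) = ev u \<otimes>\<^bsub>Iso Y\<^esub> ev v"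
  by (rule word_eval_append[OF group_Iso P]) (use S in \<open>auto simp: S_extension_def\<close>)

lemma S_extension_free_lift:
  "w \<in> lists P \<Longrightarrow> free_lift (Iso Y) \<phi> (word_rel P `` {w}) = ev w"
  by (rule free_lift_class[OF group_Iso P]) (use S in \<open>auto simp: S_extension_def\<close>)

text \<open>Each class of the free group has a representing word, and the lift of the class is the
  value of that word. From here on words replace classes.\<close>

lemma minimal_S_extension_iff:
  "minimal_S_extension a X P Y \<phi> \<longleftrightarrow> (\<forall>y\<in>mspace Y. \<exists>w\<in>lists P. y = ev w a)"
proof -
  have "(\<exists>g\<in>carrier (free_group P). y = free_lift (Iso Y) \<phi> g a) \<longleftrightarrow> (\<exists>w\<in>lists P. y = ev w a)" for y
    using S_extension_free_lift free_group_class_in_carrier free_group_carrierE by metis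
  then show ?thesis using S by (simp add: minimal_S_extension_def)
qed

lemma carrier_image_group: "carrier (image_group P Y \<phi>) = ev ` lists P"
proof -
  have "carrier (image_group P Y \<phi>) = free_lift (Iso Y) \<phi> ` carrier (free_group P)"
    by (simp add: image_group_def)
  also have "carrier (free_group P) = (\<lambda>w. word_rel P `` {w}) ` lists P"
    using free_group_class_in_carrier free_group_carrierE by (auto, blast)
  also have "free_lift (Iso Y) \<phi> ` \<dots> = ev ` lists P"
    using S_extension_free_lift by (simp add: image_image)
  finally show ?thesis .
qed

lemma mult_image_group: "x \<otimes>\<^bsub>image_group P Y \<phi>\<^esub> y = x \<otimes>\<^bsub>Iso Y\<^esub> y"
  by (simp add: image_group_def)

text \<open>The orbit of \<open>a\<close> is invariant under the generators, and it contains
  \<open>X\<close> because every other point of \<open>X\<close> is the image of \<open>a\<close>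
  under some member of \<open>P\<close>. Restriction to it makes any S-extension minimal.\<close>

lemma S_extension_orbit:
  assumes P_isom: "P \<subseteq> partial_isometries X" and a: "a \<in> mspace X" and X: "mspace X - {a} \<subseteq> images_of P a"
  defines "O' \<equiv> (\<lambda>w. ev w a) ` lists P"
  shows "minimal_S_extension a X P (submetric Y O') (\<lambda>p. restrict (\<phi> p) O')"
    and "\<And>w. w \<in> lists P \<Longrightarrow>
      word_eval (Iso (submetric Y O')) (\<lambda>p. restrict (\<phi> p) O') w = restrict (ev w) O'"
proof -
  let ?Y = "submetric Y O'" and ?\<phi> = "\<lambda>p. restrict (\<phi> p) O'"
  note SD = S_extensionD[OF S]
  have aY: "a \<in> mspace Y" using SD(1) a by (auto simp: metric_extends_def)
  have sub: "O' \<subseteq> mspace Y"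
    using isometries_closed[OF S_extension_word_closed aY] by (auto simp: O'_def)
  then have Y': "mspace ?Y = O'" by auto
  have a': "a \<in> O'"
    unfolding O'_def by (rule image_eqI[of _ _ "[]"]) (use aY in \<open>auto simp: word_eval_Nil one_Iso\<close>)
  have step: "\<phi> p y \<in> O'" if "p \<in> P" "y \<in> O'" for p y
  proof -
    obtain w where w: "w \<in> lists P" "y = ev w a" using \<open>y \<in> O'\<close> by (auto simp: O'_def)
    then have "\<phi> p y = ev (p # w) a" using S_extension_word_Cons[OF that(1) w(1) aY] by simp
    then show ?thesis using that(1) w(1) unfolding O'_def by (intro image_eqI[of _ _ "p # w"]) auto
  qed
  have cancel: "\<phi> (p\<inverse>) (\<phi> p y) = y" if p: "p \<in> P" and y: "y \<in> mspace Y" for p y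
  proof -
    interpret group "Iso Y" by (rule group_Iso)
    have "p\<inverse> \<in> P" using P p by blast
    have "\<phi> (p\<inverse>) \<otimes>\<^bsub>Iso Y\<^esub> \<phi> p = \<one>\<^bsub>Iso Y\<^esub>"
      using SD(2)[OF p] by (simp add: SD(4)[OF p] carrier_Iso)
    then have "compose (mspace Y) (\<phi> (p\<inverse>)) (\<phi> p) y = y"
      using y by (simp add: mult_Iso[OF SD(2)[OF \<open>p\<inverse> \<in> P\<close>] SD(2)[OF p]] one_Iso)
    then show ?thesis using y by (simp add: compose_eq)
  qed
  have O'_cancel: "\<phi> (p\<inverse>) (\<phi> p y) = y" if "p \<in> P" "y \<in> O'" for p y
    using cancel that sub by blast
  have pair: "?\<phi> p \<in> isometries ?Y \<and> ?\<phi> (p\<inverse>) = inv\<^bsub>Iso ?Y\<^esub> ?\<phi> p" if p: "p \<in> P" for p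
  proof -
    have p': "p\<inverse> \<in> P" using P p by blast
    have "mdist Y (\<phi> p x) (\<phi> p y) = mdist Y x y" if "x \<in> O'" "y \<in> O'" for x y
      using SD(2)[OF p] that sub by (auto simp: isometries_def)
    then show ?thesis
      using Iso_inverse_pair[of "?\<phi> p" ?Y "?\<phi> (p\<inverse>)"] step[OF p] step[OF p'] O'_cancel[OF p] O'_cancel[OF p']
      by (simp add: Y' del: mspace_submetric)
  qed
  have X': "mspace X \<subseteq> O'"
  proof
    fix x assume x: "x \<in> mspace X"
    show "x \<in> O'"
    proof (cases "x = a")
      case False
      then obtain p where p: "p \<in> P" "(a, x) \<in> p" using X x by (auto simp: images_of_def)
      then show ?thesis using step[OF p(1) a'] SD(3)[OF p] by simp
    qed (use a' in simp)
  qed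
  have S': "S_extension X P ?Y ?\<phi>"
    unfolding S_extension_def
  proof (intro conjI ballI funcsetI)
    show "metric_extends ?Y X" using SD(1) X' sub by (auto simp: metric_extends_def)
    show "?\<phi> p \<in> carrier (Iso ?Y)" if "p \<in> P" for p using pair[OF that] by (simp add: carrier_Iso)
    show "?\<phi> (p\<inverse>) = inv\<^bsub>Iso ?Y\<^esub> ?\<phi> p" if "p \<in> P" for p using pair[OF that] by blast
    show "case xy of (x, y) \<Rightarrow> ?\<phi> p x = y" if p: "p \<in> P" and xy: "xy \<in> p" for p xy
    proof -
      obtain x y where "xy = (x, y)" by force
      moreover from this have "x \<in> mspace X"
        using P_isom p xy partial_isometry_mspace(1)[of X p x y] by (auto simp: partial_isometries_def)
      ultimately show ?thesis using SD(3)[OF p, of x y] xy X' by auto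
    qed
  qed
  \<comment> \<open>The invariance of the orbit is carried along in the induction, since composing
    restrictions needs the inner values to stay in the orbit.\<close>
  have "word_eval (Iso ?Y) ?\<phi> w = restrict (ev w) O' \<and> (\<forall>x\<in>O'. ev w x \<in> O')" if "w \<in> lists P" for w
    using that
  proof (induction w)
    case Nil
    then show ?case using sub Y' by (auto simp: word_eval_Nil one_Iso restrict_def fun_eq_iff)
  next
    case (Cons p w)
    then have p: "p \<in> P" and w: "w \<in> lists P" by auto
    have IH: "word_eval (Iso ?Y) ?\<phi> w = restrict (ev w) O'" "\<And>x. x \<in> O' \<Longrightarrow> ev w x \<in> O'"
      using Cons.IH w by blast+
    have "word_eval (Iso ?Y) ?\<phi> w \<in> isometries ?Y"
      unfolding carrier_Iso[symmetric]
      by (rule word_eval_closed[OF group_Iso P _ _ w]) (use S' in \<open>auto simp: S_extension_def\<close>)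
    then have "word_eval (Iso ?Y) ?\<phi> (p # w) = compose O' (?\<phi> p) (restrict (ev w) O')"
      using pair[OF p] by (simp add: word_eval_Cons mult_Iso IH(1) Y' del: mspace_submetric)
    moreover have "ev (p # w) x = \<phi> p (ev w x)" if "x \<in> O'" for x
      using S_extension_word_Cons[OF p w] that sub by blast
    ultimately show ?case using IH(2) step[OF p] by (auto simp: compose_def restrict_def)
  qed
  then show ev': "\<And>w. w \<in> lists P \<Longrightarrow> word_eval (Iso ?Y) ?\<phi> w = restrict (ev w) O'" by blast
  show "minimal_S_extension a X P ?Y ?\<phi>"
    unfolding minimal_S_extension_def
  proof (intro conjI ballI S')
    fix y assume "y \<in> mspace ?Y"
    then obtain w where w: "w \<in> lists P" "y = ev w a" by (auto simp: O'_def)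
    have "free_lift (Iso ?Y) ?\<phi> (word_rel P `` {w}) = word_eval (Iso ?Y) ?\<phi> w"
      by (rule free_lift_class[OF group_Iso P _ _ w(1)]) (use S' in \<open>auto simp: S_extension_def\<close>)
    then show "\<exists>g\<in>carrier (free_group P). y = free_lift (Iso ?Y) ?\<phi> g a"
      using free_group_class_in_carrier[OF w(1)] ev'[OF w(1)] w(2) a'
      by (intro bexI[of _ "word_rel P `` {w}"]) simp_all
  qed
qed

end


section \<open>Action of the isometries of a subspace\<close>

lemma metric_extends_trans: "metric_extends Z Y \<Longrightarrow> metric_extends Y X \<Longrightarrow> metric_extends Z X"
  unfolding metric_extends_def by (metis subset_iff)

definition graph_of :: "'a metric \<Rightarrow> ('a \<Rightarrow> 'a) \<Rightarrow> ('a \<times> 'a) set"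
  where "graph_of Y f = (\<lambda>y. (y, f y)) ` mspace Y"

text \<open>The graph of an isometry of \<open>Y\<close> has all of \<open>Y\<close> as its domain
  and as its range. Coherence therefore applies to any two such graphs, and \<open>T\<close> is a
  homomorphism from \<open>Iso Y\<close> to \<open>Iso V\<close> extending each isometry.\<close>

lemma isometry_group_action:
  fixes Y :: "'a metric"
  assumes fin: "finite (mspace Y)" and Z: "metric_extends Z Y" and V: "metric_extends V Z"
    and \<alpha>: "extending_action Z (mspace V) \<alpha>"
    and \<alpha>_isom: "\<forall>p. partial_isometry Z p \<longrightarrow>
      (\<forall>x\<in>mspace V. \<forall>y\<in>mspace V. mdist V (\<alpha> p x) (\<alpha> p y) = mdist V x y)"
  defines "T \<equiv> \<lambda>f. restrict (\<alpha> (graph_of Y f)) (mspace V)"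
  shows "f \<in> isometries Y \<Longrightarrow> T f \<in> isometries V"
    and "f \<in> isometries Y \<Longrightarrow> T (inv\<^bsub>Iso Y\<^esub> f) = inv\<^bsub>Iso V\<^esub> T f"
    and "f \<in> isometries Y \<Longrightarrow> g \<in> isometries Y \<Longrightarrow> T (f \<otimes>\<^bsub>Iso Y\<^esub> g) = T f \<otimes>\<^bsub>Iso V\<^esub> T g"
    and "T \<one>\<^bsub>Iso Y\<^esub> = \<one>\<^bsub>Iso V\<^esub>"
    and "f \<in> isometries Y \<Longrightarrow> y \<in> mspace Y \<Longrightarrow> T f y = f y"
proof -
  let ?G = "graph_of Y"
  note \<alpha>D = extending_actionD[OF \<alpha>]
  interpret group "Iso Y" by (rule group_Iso)
  have isom: "partial_isometry Z (?G f)" if "f \<in> isometries Y" for f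
  proof (rule partial_isometry_extends[OF Z])
    show "partial_isometry Y (?G f)"
      using that isometries_closed[OF that] fin
      by (auto simp: partial_isometry_def graph_of_def single_valued_def isometries_def)
  qed
  have dom: "Domain (?G f) = mspace Y" "Range (?G f) = mspace Y" if "f \<in> isometries Y" for f
    using that
    by (simp_all add: graph_of_def isometries_def Bij_def bij_betw_def Domain_fst Range_snd image_image)
  \<comment> \<open>The order is reversed: the group product applies \<open>g\<close> first, and so
    does the relational composition written from left to right.\<close>
  have comp: "?G (f \<otimes>\<^bsub>Iso Y\<^esub> g) = ?G g O ?G f" if "f \<in> isometries Y" "g \<in> isometries Y" for f g
    using isometries_closed[OF that(2)]
    by (auto simp: graph_of_def mult_Iso[OF that] compose_eq relcomp_unfold)
  have mult: "\<alpha> (?G (f \<otimes>\<^bsub>Iso Y\<^esub> g)) x = \<alpha> (?G f) (\<alpha> (?G g) x)"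
    if "f \<in> isometries Y" "g \<in> isometries Y" "x \<in> mspace V" for f g x
    using coherent_action_comp[OF \<alpha>D(2) isom[OF that(2)] isom[OF that(1)] _ that(3)] that
    by (simp add: comp dom)
  have closed: "\<alpha> (?G f) x \<in> mspace V" if "f \<in> isometries Y" "x \<in> mspace V" for f x
    using coherent_action_closed[OF \<alpha>D(2) isom] that by blast
  have one_in: "\<one>\<^bsub>Iso Y\<^esub> \<in> isometries Y" using one_closed by (simp add: carrier_Iso)
  have one: "\<alpha> (?G \<one>\<^bsub>Iso Y\<^esub>) x = x" if "x \<in> mspace V" for x
    by (rule coherent_action_id[OF \<alpha>D(2) isom[OF one_in] _ that]) (auto simp: graph_of_def one_Iso)
  show "T \<one>\<^bsub>Iso Y\<^esub> = \<one>\<^bsub>Iso V\<^esub>"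
    using one by (simp add: T_def one_Iso[of V] cong: restrict_cong)
  show "T f y = f y" if "f \<in> isometries Y" "y \<in> mspace Y" for f y
    using \<alpha>D(3)[OF isom[OF that(1)], of y "f y"] that Z V
    by (auto simp: T_def graph_of_def metric_extends_def)
  have inv: "T f \<in> isometries V \<and> T (inv\<^bsub>Iso Y\<^esub> f) = inv\<^bsub>Iso V\<^esub> T f" if f: "f \<in> isometries Y" for f
  proof -
    have g: "inv\<^bsub>Iso Y\<^esub> f \<in> isometries Y" using f inv_closed by (simp add: carrier_Iso)
    have 1: "inv\<^bsub>Iso Y\<^esub> f \<otimes>\<^bsub>Iso Y\<^esub> f = \<one>\<^bsub>Iso Y\<^esub>" "f \<otimes>\<^bsub>Iso Y\<^esub> inv\<^bsub>Iso Y\<^esub> f = \<one>\<^bsub>Iso Y\<^esub>"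
      using f by (simp_all add: carrier_Iso)
    have "\<alpha> (?G (inv\<^bsub>Iso Y\<^esub> f)) (\<alpha> (?G f) x) = x" "\<alpha> (?G f) (\<alpha> (?G (inv\<^bsub>Iso Y\<^esub> f)) x) = x"
      if "x \<in> mspace V" for x
      using mult[OF g f that] mult[OF f g that] one[OF that] by (simp_all add: 1)
    then show ?thesis
      using Iso_inverse_pair[of "T f" V "T (inv\<^bsub>Iso Y\<^esub> f)"] closed[OF f] closed[OF g] \<alpha>_isom isom[OF f]
      by (simp add: T_def)
  qed
  show "f \<in> isometries Y \<Longrightarrow> T f \<in> isometries V"
    "f \<in> isometries Y \<Longrightarrow> T (inv\<^bsub>Iso Y\<^esub> f) = inv\<^bsub>Iso V\<^esub> T f" for f
    using inv by blast+
  show "T (f \<otimes>\<^bsub>Iso Y\<^esub> g) = T f \<otimes>\<^bsub>Iso V\<^esub> T g" if "f \<in> isometries Y" "g \<in> isometries Y" for f g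
    using inv that mult[OF that] closed[OF that(2)]
    by (simp add: mult_Iso) (simp add: T_def compose_def cong: restrict_cong)
qed

section \<open>The coherent minimal extension\<close>

text \<open>The points of \<open>Y\<^sub>2\<close> come from the type \<open>'a\<close> itself,
  hence its infinity. Since \<open>Y\<^sub>2\<close> is to extend both \<open>X\<^sub>2\<close> and
  \<open>Y\<^sub>1\<close>, their metrics must agree on common points.\<close>

theorem theorem5p6:
  fixes X\<^sub>1 X\<^sub>2 Y\<^sub>1 :: "'a metric"
    and a\<^sub>0 :: 'a
    and P\<^sub>1 P\<^sub>2 :: "('a \<times> 'a) set set"
    and \<phi>\<^sub>1 :: "('a \<times> 'a) set \<Rightarrow> 'a \<Rightarrow> 'a"
  assumes "infinite (UNIV :: 'a set)"
    and "finite (mspace X\<^sub>1)" and "finite (mspace X\<^sub>2)"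
    and "metric_extends X\<^sub>2 X\<^sub>1"
    and "a\<^sub>0 \<in> mspace X\<^sub>1"
    and "P\<^sub>1 \<subseteq> partial_isometries X\<^sub>1" and "P\<^sub>1 = converse ` P\<^sub>1"
    and "mspace X\<^sub>1 - {a\<^sub>0} \<subseteq> images_of P\<^sub>1 a\<^sub>0"
    and "finite (mspace Y\<^sub>1)" and "minimal_S_extension a\<^sub>0 X\<^sub>1 P\<^sub>1 Y\<^sub>1 \<phi>\<^sub>1"
    and "\<forall>x\<in>mspace X\<^sub>2 \<inter> mspace Y\<^sub>1. \<forall>y\<in>mspace X\<^sub>2 \<inter> mspace Y\<^sub>1. mdist X\<^sub>2 x y = mdist Y\<^sub>1 x y"
    and "P\<^sub>1 \<subseteq> P\<^sub>2" and "P\<^sub>2 \<subseteq> partial_isometries X\<^sub>2" and "P\<^sub>2 = converse ` P\<^sub>2"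
    and "mspace X\<^sub>2 - {a\<^sub>0} \<subseteq> images_of P\<^sub>2 a\<^sub>0"
  shows "\<exists>Y\<^sub>2 \<phi>\<^sub>2. finite (mspace Y\<^sub>2) \<and> minimal_S_extension a\<^sub>0 X\<^sub>2 P\<^sub>2 Y\<^sub>2 \<phi>\<^sub>2 \<and>
           coherent P\<^sub>1 Y\<^sub>1 \<phi>\<^sub>1 P\<^sub>2 Y\<^sub>2 \<phi>\<^sub>2"
proof -
  note P\<^sub>1 = assms(7)[symmetric] and P\<^sub>2 = assms(14)[symmetric]
  have S\<^sub>1: "S_extension X\<^sub>1 P\<^sub>1 Y\<^sub>1 \<phi>\<^sub>1" using assms(10) by (simp add: minimal_S_extension_def)
  note S\<^sub>1D = S_extensionD[OF S\<^sub>1]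
  have a\<^sub>0: "a\<^sub>0 \<in> mspace X\<^sub>2" "a\<^sub>0 \<in> mspace Y\<^sub>1" using assms(4,5) S\<^sub>1D(1) by (auto simp: metric_extends_def)
  obtain Z where Z: "mspace Z = mspace X\<^sub>2 \<union> mspace Y\<^sub>1" "metric_extends Z X\<^sub>2" "metric_extends Z Y\<^sub>1"
  proof (rule metric_amalgam[of X\<^sub>2 Y\<^sub>1])
    show "finite (mspace X\<^sub>2 \<inter> mspace Y\<^sub>1)" using assms(3) by simp
    show "mspace X\<^sub>2 \<inter> mspace Y\<^sub>1 \<noteq> {}" using a\<^sub>0 by blast
  qed (use assms(11) in auto)
  have "finite (mspace Z)" using Z(1) assms(3,9) by simp
  then obtain Y \<alpha> where Y: "finite (mspace Y)" "metric_extends Y Z" "extending_action Z (mspace Y) \<alpha>"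
    and \<alpha>_isom: "\<And>p x y. partial_isometry Z p \<Longrightarrow> x \<in> mspace Y \<Longrightarrow> y \<in> mspace Y \<Longrightarrow>
      mdist Y (\<alpha> p x) (\<alpha> p y) = mdist Y x y"
    using coherent_EPPA[OF assms(1), of Z] by blast
  note \<alpha>D = extending_actionD[OF Y(3)]
  have \<alpha>_isom': "\<forall>p. partial_isometry Z p \<longrightarrow>
      (\<forall>x\<in>mspace Y. \<forall>y\<in>mspace Y. mdist Y (\<alpha> p x) (\<alpha> p y) = mdist Y x y)"
    using \<alpha>_isom by blast
  define T where "T f = restrict (\<alpha> (graph_of Y\<^sub>1 f)) (mspace Y)" for f
  note T = isometry_group_action[OF assms(9) Z(3) Y(2,3), folded T_def, OF \<alpha>_isom']
  \<comment> \<open>For \<open>p\<close> in \<open>P\<^sub>1\<close> it is the full isometry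
    \<open>\<phi>\<^sub>1 p\<close> of \<open>Y\<^sub>1\<close> that gets extended, not just
    \<open>p\<close>: this gives coherence on \<open>Y\<^sub>1\<close> and makes words over
    \<open>P\<^sub>1\<close> multiply through \<open>T\<close>.\<close>
  define \<phi> where "\<phi> p = (if p \<in> P\<^sub>1 then T (\<phi>\<^sub>1 p) else restrict (\<alpha> p) (mspace Y))" for p
  have P\<^sub>2_isom: "partial_isometry Z p" if "p \<in> P\<^sub>2" for p
    using that assms(13) partial_isometry_extends[OF Z(2)] by (auto simp: partial_isometries_def)
  have \<phi>_pair: "\<phi> p \<in> isometries Y \<and> \<phi> (p\<inverse>) = inv\<^bsub>Iso Y\<^esub> \<phi> p" if p: "p \<in> P\<^sub>2" for p
  proof (cases "p \<in> P\<^sub>1")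
    case True
    then have "p\<inverse> \<in> P\<^sub>1" using P\<^sub>1 by blast
    then show ?thesis using True T(1,2) S\<^sub>1D(2,4)[OF True] by (simp add: \<phi>_def)
  next
    case False
    \<comment> \<open>As \<open>P\<^sub>1\<close> is closed under converses, \<open>p\<close> and
      its converse always fall under the same case of the definition.\<close>
    then have p': "p\<inverse> \<notin> P\<^sub>1" using P\<^sub>1 by (metis converse_converse image_eqI)
    note isom = P\<^sub>2_isom[OF p] partial_isometry_converse[OF P\<^sub>2_isom[OF p]]
    show ?thesis
      using Iso_inverse_pair[of "\<phi> p" Y "\<phi> (p\<inverse>)"] coherent_action_closed[OF \<alpha>D(2)] isom
        coherent_action_converse[OF \<alpha>D(2) isom(1)] coherent_action_converse'[OF \<alpha>D(2) isom(1)]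
        \<alpha>_isom[OF isom(1)]
      by (simp add: \<phi>_def False p')
  qed
  have S: "S_extension X\<^sub>2 P\<^sub>2 Y \<phi>"
    unfolding S_extension_def
  proof (intro conjI ballI funcsetI)
    show "metric_extends Y X\<^sub>2" using Y(2) Z(2) by (rule metric_extends_trans)
    show "\<phi> p \<in> carrier (Iso Y)" "\<phi> (p\<inverse>) = inv\<^bsub>Iso Y\<^esub> \<phi> p" if "p \<in> P\<^sub>2" for p
      using \<phi>_pair[OF that] by (simp_all add: carrier_Iso)
    show "case xy of (x, y) \<Rightarrow> \<phi> p x = y" if p: "p \<in> P\<^sub>2" and xy: "xy \<in> p" for p xy
    proof -
      obtain x y where xy': "xy = (x, y)" by force
      show ?thesis
      proof (cases "p \<in> P\<^sub>1")
        case True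
        then have "x \<in> mspace X\<^sub>1"
          using assms(6) xy partial_isometry_mspace(1)[of X\<^sub>1 p x y] by (auto simp: partial_isometries_def xy')
        then have "x \<in> mspace Y\<^sub>1" using S\<^sub>1D(1) by (auto simp: metric_extends_def)
        then show ?thesis
          using True T(5) S\<^sub>1D(2,3)[OF True] xy by (simp add: \<phi>_def xy')
      next
        case False
        then show ?thesis
          using \<alpha>D(1,3) P\<^sub>2_isom[OF p] partial_isometry_mspace(1)[OF P\<^sub>2_isom[OF p], of x y] xy
          by (auto simp: \<phi>_def xy')
      qed
    qed
  qed
  define O' where "O' = (\<lambda>w. word_eval (Iso Y) \<phi> w a\<^sub>0) ` lists P\<^sub>2"
  define Y\<^sub>2 where "Y\<^sub>2 = submetric Y O'"
  define \<phi>\<^sub>2 where "\<phi>\<^sub>2 p = restrict (\<phi> p) O'" for p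
  note orbit = S_extension_orbit[OF S P\<^sub>2 assms(13) a\<^sub>0(1) assms(15), folded O'_def,
      folded Y\<^sub>2_def \<phi>\<^sub>2_def[abs_def]]
  have S\<^sub>2: "S_extension X\<^sub>2 P\<^sub>2 Y\<^sub>2 \<phi>\<^sub>2" using orbit(1) by (simp add: minimal_S_extension_def)
  have lists: "w \<in> lists P\<^sub>2" if "w \<in> lists P\<^sub>1" for w using that assms(12) by auto
  let ?ev\<^sub>1 = "word_eval (Iso Y\<^sub>1) \<phi>\<^sub>1" and ?ev\<^sub>2 = "word_eval (Iso Y\<^sub>2) \<phi>\<^sub>2"
  note closed\<^sub>1 = S_extension_word_closed[OF S\<^sub>1 P\<^sub>1]
  \<comment> \<open>Because \<open>T\<close> is multiplicative, the value of a word over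
    \<open>P\<^sub>1\<close> in \<open>Iso Y\<close> depends only on its value in
    \<open>Iso Y\<^sub>1\<close>.\<close>
  have ev: "word_eval (Iso Y) \<phi> w = T (?ev\<^sub>1 w)" if "w \<in> lists P\<^sub>1" for w
    using that
  proof (induction w)
    case (Cons p w)
    then show ?case
      using T(3)[OF S\<^sub>1D(2)[of p] closed\<^sub>1[of w]] by (simp add: word_eval_Cons \<phi>_def)
  qed (simp add: word_eval_Nil T(4))
  have ev\<^sub>2: "?ev\<^sub>2 w = restrict (T (?ev\<^sub>1 w)) O'" if "w \<in> lists P\<^sub>1" for w
    using orbit(2)[OF lists[OF that]] ev[OF that] by simp
  \<comment> \<open>Here minimality of the given extension enters: each point of
    \<open>Y\<^sub>1\<close> is reached from \<open>a\<^sub>0\<close> by a word over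
    \<open>P\<^sub>1\<close>, and the same word reaches it in \<open>Y\<close>.\<close>
  have Y\<^sub>1_sub: "mspace Y\<^sub>1 \<subseteq> O'"
  proof
    fix y assume "y \<in> mspace Y\<^sub>1"
    then obtain w where w: "w \<in> lists P\<^sub>1" "y = ?ev\<^sub>1 w a\<^sub>0"
      using assms(10) minimal_S_extension_iff[OF S\<^sub>1 P\<^sub>1] by blast
    then have "y = word_eval (Iso Y) \<phi> w a\<^sub>0" using ev T(5)[OF closed\<^sub>1 a\<^sub>0(2)] by simp
    then show "y \<in> O'" using lists[OF w(1)] by (auto simp: O'_def)
  qed
  have ext: "metric_extends Y\<^sub>2 Y\<^sub>1"
    using metric_extends_trans[OF Y(2) Z(3)] Y\<^sub>1_sub by (auto simp: Y\<^sub>2_def metric_extends_def)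
  have K\<^sub>1: "carrier (image_group P\<^sub>1 Y\<^sub>1 \<phi>\<^sub>1) = ?ev\<^sub>1 ` lists P\<^sub>1"
    and K\<^sub>2: "carrier (image_group P\<^sub>2 Y\<^sub>2 \<phi>\<^sub>2) = ?ev\<^sub>2 ` lists P\<^sub>2"
    using carrier_image_group[OF S\<^sub>1 P\<^sub>1] carrier_image_group[OF S\<^sub>2 P\<^sub>2] by auto
  \<comment> \<open>Defining \<open>h\<close> by \<open>T\<close> instead of on words makes it well
    defined at once.\<close>
  define h where "h = (\<lambda>g\<in>?ev\<^sub>1 ` lists P\<^sub>1. restrict (T g) O')"
  have h: "h (?ev\<^sub>1 w) = ?ev\<^sub>2 w" if "w \<in> lists P\<^sub>1" for w
    using that ev\<^sub>2[OF that] by (simp add: h_def)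
  have gen: "?ev\<^sub>1 [p] = \<phi>\<^sub>1 p" "?ev\<^sub>2 [p] = \<phi>\<^sub>2 p" if "p \<in> P\<^sub>1" for p
  proof -
    interpret G\<^sub>1: group "Iso Y\<^sub>1" by (rule group_Iso)
    interpret G\<^sub>2: group "Iso Y\<^sub>2" by (rule group_Iso)
    show "?ev\<^sub>1 [p] = \<phi>\<^sub>1 p" "?ev\<^sub>2 [p] = \<phi>\<^sub>2 p"
      using S\<^sub>1D(2)[OF that] S_extensionD(2)[OF S\<^sub>2, of p] that assms(12)
      by (auto simp: word_eval_Cons word_eval_Nil carrier_Iso)
  qed
  have h_mon: "h \<in> mon (image_group P\<^sub>1 Y\<^sub>1 \<phi>\<^sub>1) (image_group P\<^sub>2 Y\<^sub>2 \<phi>\<^sub>2)"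
    unfolding mon_def hom_def K\<^sub>1 K\<^sub>2 mem_Collect_eq
  proof (intro conjI ballI funcsetI inj_onI)
    show "h g \<in> ?ev\<^sub>2 ` lists P\<^sub>2" if "g \<in> ?ev\<^sub>1 ` lists P\<^sub>1" for g
      using that h lists by auto
    show "h (f \<otimes>\<^bsub>image_group P\<^sub>1 Y\<^sub>1 \<phi>\<^sub>1\<^esub> g) = h f \<otimes>\<^bsub>image_group P\<^sub>2 Y\<^sub>2 \<phi>\<^sub>2\<^esub> h g"
      if f: "f \<in> ?ev\<^sub>1 ` lists P\<^sub>1" and g: "g \<in> ?ev\<^sub>1 ` lists P\<^sub>1" for f g
    proof -
      obtain u v where uv: "u \<in> lists P\<^sub>1" "f = ?ev\<^sub>1 u" "v \<in> lists P\<^sub>1" "g = ?ev\<^sub>1 v" using f g by blast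
      then have "h (f \<otimes>\<^bsub>Iso Y\<^sub>1\<^esub> g) = ?ev\<^sub>2 (u @ v)"
        using S_extension_word_append[OF S\<^sub>1 P\<^sub>1 uv(1,3)] h[of "u @ v"] by simp
      then show ?thesis
        using S_extension_word_append[OF S\<^sub>2 P\<^sub>2 lists[OF uv(1)] lists[OF uv(3)]] h uv
        by (simp add: image_group_def)
    qed
    \<comment> \<open>The orbit contains \<open>Y\<^sub>1\<close>, and \<open>T f\<close> agrees
      with \<open>f\<close> there, so \<open>f\<close> can be read off from its image.\<close>
    show "f = g" if f: "f \<in> ?ev\<^sub>1 ` lists P\<^sub>1" and g: "g \<in> ?ev\<^sub>1 ` lists P\<^sub>1" and eq: "h f = h g" for f g
    proof -
      have fg: "f \<in> isometries Y\<^sub>1" "g \<in> isometries Y\<^sub>1" using f g closed\<^sub>1 by auto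
      have "f y = g y" if y: "y \<in> mspace Y\<^sub>1" for y
      proof -
        have "restrict (T f) O' y = restrict (T g) O' y" using eq f g by (simp add: h_def)
        then show ?thesis using T(5) fg y Y\<^sub>1_sub by auto
      qed
      then show ?thesis using fg by (metis extensionalityI isometries_extensional)
    qed
  qed
  have unique: "h' = h"
    if h': "h' \<in> extensional (carrier (image_group P\<^sub>1 Y\<^sub>1 \<phi>\<^sub>1))"
      "h' \<in> mon (image_group P\<^sub>1 Y\<^sub>1 \<phi>\<^sub>1) (image_group P\<^sub>2 Y\<^sub>2 \<phi>\<^sub>2)" "\<forall>p\<in>P\<^sub>1. h' (\<phi>\<^sub>1 p) = \<phi>\<^sub>2 p" for h'
  proof -
    interpret G\<^sub>1: group "Iso Y\<^sub>1" by (rule group_Iso)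
    interpret G\<^sub>2: group "Iso Y\<^sub>2" by (rule group_Iso)
    have mult: "h' (?ev\<^sub>1 u \<otimes>\<^bsub>Iso Y\<^sub>1\<^esub> ?ev\<^sub>1 v) = h' (?ev\<^sub>1 u) \<otimes>\<^bsub>Iso Y\<^sub>2\<^esub> h' (?ev\<^sub>1 v)"
      if "u \<in> lists P\<^sub>1" "v \<in> lists P\<^sub>1" for u v
      using h'(2) that by (simp add: mon_def hom_def K\<^sub>1 mult_image_group[OF S\<^sub>1 P\<^sub>1] mult_image_group[OF S\<^sub>2 P\<^sub>2])
    have closed: "h' (?ev\<^sub>1 w) \<in> carrier (Iso Y\<^sub>2)" if "w \<in> lists P\<^sub>1" for w
    proof -
      have "h' \<in> ?ev\<^sub>1 ` lists P\<^sub>1 \<rightarrow> ?ev\<^sub>2 ` lists P\<^sub>2" using h'(2) by (simp add: mon_def hom_def K\<^sub>1 K\<^sub>2)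
      then have "h' (?ev\<^sub>1 w) \<in> ?ev\<^sub>2 ` lists P\<^sub>2" using imageI[OF that] by (rule funcset_mem)
      then obtain v where "h' (?ev\<^sub>1 w) = ?ev\<^sub>2 v" "v \<in> lists P\<^sub>2" by (rule imageE)
      then show ?thesis using S_extension_word_closed[OF S\<^sub>2 P\<^sub>2, of v] by (simp add: carrier_Iso)
    qed
    have hw: "h' (?ev\<^sub>1 w) = ?ev\<^sub>2 w" if "w \<in> lists P\<^sub>1" for w
      using that
    proof (induction w)
      case Nil
      \<comment> \<open>Membership in \<open>mon\<close> does not state that the unit is preserved;
        its image is idempotent, hence the unit of the group.\<close>
      have "h' (?ev\<^sub>1 []) \<otimes>\<^bsub>Iso Y\<^sub>2\<^esub> h' (?ev\<^sub>1 []) = h' (?ev\<^sub>1 [])"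
        using mult[of "[]" "[]"] by (simp add: word_eval_Nil)
      then show ?case using closed[of "[]"] by (simp add: word_eval_Nil)
    next
      case (Cons p w)
      then show ?case
        using mult[of "[p]" w] gen[of p] h'(3) by (simp add: word_eval_Cons[of _ _ p w])
    qed
    have "h' g = h g" if g: "g \<in> ?ev\<^sub>1 ` lists P\<^sub>1" for g
    proof -
      obtain w where w: "g = ?ev\<^sub>1 w" "w \<in> lists P\<^sub>1" using g by (rule imageE)
      show ?thesis using hw[OF w(2)] h[OF w(2)] w(1) by simp
    qed
    then show ?thesis
      using h'(1) unfolding K\<^sub>1 h_def by (intro extensionalityI[of _ "?ev\<^sub>1 ` lists P\<^sub>1"]) auto
  qed
  have "coherent P\<^sub>1 Y\<^sub>1 \<phi>\<^sub>1 P\<^sub>2 Y\<^sub>2 \<phi>\<^sub>2"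
    unfolding coherent_def
  proof (intro conjI ballI ext ex1I[of _ h])
    show "\<phi>\<^sub>2 p y = \<phi>\<^sub>1 p y" if "p \<in> P\<^sub>1" "y \<in> mspace Y\<^sub>1" for p y
      using that Y\<^sub>1_sub T(5)[OF S\<^sub>1D(2)[OF that(1)] that(2)] by (auto simp: \<phi>\<^sub>2_def \<phi>_def)
    show "h \<in> extensional (carrier (image_group P\<^sub>1 Y\<^sub>1 \<phi>\<^sub>1))" by (simp add: K\<^sub>1 h_def)
    show "h (\<phi>\<^sub>1 p) = \<phi>\<^sub>2 p" if "p \<in> P\<^sub>1" for p using h[of "[p]"] gen[OF that] that by simp
  qed (use h_mon unique in blast)+
  moreover have "finite (mspace Y\<^sub>2)" using Y(1) by (simp add: Y\<^sub>2_def)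
  ultimately show ?thesis using orbit(1) by blast
qed

end
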